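(* Let $f:\mathbb{R}^d\to\mathbb{R}$ satisfy the following three assumptions. (1) $f\in C^2(\mathbb{R}^d)$ and there exists $M>0$ such that $\|\nabla^2 f(x)\|\le M$ for all $x\in\mathbb{R}^d$. (2) For every $x^*\in\mathrm{Crit}_s(f)$, the Hessian $\nabla^2 f(x^* )$ is non-degenerate (all its eigenvalues are nonzero). (3) For every $x^*\in\mathrm{Crit}_s(f)$, with $H=\nabla^2 f(x^* )$, one has $\mathcal{P}_+^H(\omega)e_i\neq 0$ for every $i\in\{1,\dots,d\}$ and almost every $\omega\in\Omega$. Suppose moreover that $0<\alpha_{\min}<\alpha_{\max}<1/M$. Then for any $x_0\in\mathbb{R}^d\setminus\mathrm{Crit}_s(f)$, $$\mathbb{P}\bigl(\Omega_s(\mathrm{Crit}_s(f),x_0)\bigr)=0 .$$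
   Context: $\mathbb{N}=\{0,1,2,\dots\}$; $e_1,\dots,e_d$ is the standard basis of $\mathbb{R}^d$; $\|\cdot\|$ is the Euclidean norm on vectors and the operator norm on matrices. Probability space: for $t\in\mathbb{N}$ let $(\Omega_t,\Sigma_t,\mathbb{P}_t)$ be $\{1,\dots,d\}\times[\alpha_{\min},\alpha_{\max}]$ with the product of the two uniform distributions, and let $(\Omega,\mathcal{F},\mathbb{P})$ be the product of all these spaces over $t\in\mathbb{N}$. Write $\omega=((i_0,\alpha_0),(i_1,\alpha_1),\dots)\in\Omega$, and let $\tau:\Omega\to\Omega$ be the left shift. Randomized coordinate gradient descent: given $x_0\in\mathbb{R}^d$ and $\omega\in\Omega$, $x_{t+1}=x_t-\alpha_t e_{i_t}e_{i_t}^{\top}\nabla f(x_t)$ for $t\in\mathbb{N}$. Strict saddle points: $\mathrm{Crit}_s(f)=\{x\in\mathbb{R}^d:\nabla f(x)=0,\ \lambda_{\min}(\nabla^2 f(x))<0\}$. For $x^*\in\mathrm{Crit}_s(f)$, $\Omega_s(x^*,x_0)=\{\omega\in\Omega:\lim_{t\to\infty}x_t=x^*\}$, and $\Omega_s(\mathrm{Crit}_s(f),x_0)=\bigcup_{x^*\in\mathrm{Crit}_s(f)}\Omega_s(x^*,x_0)$. Linearized system: for a symmetric matrix $H\in\mathbb{R}^{d\times d}$ with $\alpha_{\max}|H_{ii}|<1$ for all $i$, let $A^H(\omega)=I-\alpha_0 e_{i_0}e_{i_0}^{\top}H$ and $\Phi^H(t,\omega)=A^H(\tau^{t-1}\omega)\cdots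 A^H(\tau\omega)A^H(\omega)$. By the multiplicative ergodic theorem, for almost every $\omega$ the limit $\Lambda^H(\omega)=\lim_{t\to\infty}\bigl(\Phi^H(t,\omega)^{\top}\Phi^H(t,\omega)\bigr)^{1/2t}$ exists and is positive definite. Write its distinct eigenvalues as $e^{\lambda_1}>\dots>e^{\lambda_p}$ (the $\lambda_i$ are the Lyapunov exponents) with eigenspaces $V_i^H(\omega)$. Then $W_+^H(\omega)=\bigoplus_{\lambda_i>0}V_i^H(\omega)$ and $\mathcal{P}_+^H(\omega)$ is the orthogonal projection onto $W_+^H(\omega)$. *)

theory Defs
  imports "HOL-Probability.Probability"
begin

text \<open>The index set of the coordinates is the finite type \<open>'n\<close>, so that $d$ is \<open>CARD('n)\<close> and
  $e_i$ is \<open>axis i 1\<close>.\<close>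

definition grad :: "(real^'n \<Rightarrow> real) \<Rightarrow> real^'n \<Rightarrow> real^'n" where
  "grad f x = (\<chi> i. frechet_derivative f (at x) (axis i 1))"

definition hessian :: "(real^'n \<Rightarrow> real) \<Rightarrow> real^'n \<Rightarrow> real^'n^'n" where
  "hessian f x = jacobian (grad f) (at x)"

definition C2 :: "(real^'n \<Rightarrow> real) \<Rightarrow> bool" where
  "C2 f \<longleftrightarrow> (\<forall>x. f differentiable (at x)) \<and> (\<forall>x. grad f differentiable (at x)) \<and>
     continuous_on UNIV (hessian f)"

definition eigenspace :: "real^'n^'n \<Rightarrow> real \<Rightarrow> (real^'n) set" where
  "eigenspace A l = {v. A *v v = l *\<^sub>R v}"

definition eigenvalues :: "real^'n^'n \<Rightarrow> real set" where
  "eigenvalues A = {l. \<exists>v\<in>eigenspace A l. v \<noteq> 0}"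

text \<open>Only used for symmetric matrices, whose set of real eigenvalues is finite and nonempty.\<close>

definition lambda_min :: "real^'n^'n \<Rightarrow> real" where
  "lambda_min A = Min (eigenvalues A)"

definition crit_s :: "(real^'n \<Rightarrow> real) \<Rightarrow> (real^'n) set" where
  "crit_s f = {x. grad f x = 0 \<and> lambda_min (hessian f x) < 0}"

definition step_space :: "real \<Rightarrow> real \<Rightarrow> ('n::finite \<times> real) measure" where
  "step_space a b =
     uniform_count_measure UNIV \<Otimes>\<^sub>M uniform_measure (restrict_space lborel {a..b}) {a..b}"

definition path_space :: "real \<Rightarrow> real \<Rightarrow> (nat \<Rightarrow> 'n::finite \<times> real) measure" where
  "path_space a b = (\<Pi>\<^sub>M t\<in>UNIV. step_space a b)"

definition shift :: "(nat \<Rightarrow> 'a) \<Rightarrow> nat \<Rightarrow> 'a" where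
  "shift \<omega> = (\<lambda>t. \<omega> (Suc t))"

text \<open>The matrix $e_i e_i^{\top}$.\<close>

definition coord_mat :: "'n::finite \<Rightarrow> real^'n^'n" where
  "coord_mat i = (\<chi> r c. axis i 1 $ r * axis i 1 $ c)"

primrec rcgd :: "(real^'n \<Rightarrow> real) \<Rightarrow> real^'n \<Rightarrow> (nat \<Rightarrow> 'n \<times> real) \<Rightarrow> nat \<Rightarrow> real^'n" where
  "rcgd f x0 \<omega> 0 = x0"
| "rcgd f x0 \<omega> (Suc t) =
     rcgd f x0 \<omega> t - snd (\<omega> t) *\<^sub>R (coord_mat (fst (\<omega> t)) *v grad f (rcgd f x0 \<omega> t))"

definition Omega_s ::
  "(real^'n \<Rightarrow> real) \<Rightarrow> real \<Rightarrow> real \<Rightarrow> real^'n \<Rightarrow> real^'n \<Rightarrow> (nat \<Rightarrow> 'n \<times> real) set" where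
  "Omega_s f a b xs x0 = {\<omega> \<in> space (path_space a b). rcgd f x0 \<omega> \<longlonglongrightarrow> xs}"

definition Omega_s_crit ::
  "(real^'n \<Rightarrow> real) \<Rightarrow> real \<Rightarrow> real \<Rightarrow> real^'n \<Rightarrow> (nat \<Rightarrow> 'n \<times> real) set" where
  "Omega_s_crit f a b x0 = (\<Union>xs\<in>crit_s f. Omega_s f a b xs x0)"

definition lin_step :: "real^'n^'n \<Rightarrow> (nat \<Rightarrow> 'n \<times> real) \<Rightarrow> real^'n^'n" where
  "lin_step H \<omega> = mat 1 - snd (\<omega> 0) *\<^sub>R (coord_mat (fst (\<omega> 0)) ** H)"

primrec lin_cocycle :: "real^'n^'n \<Rightarrow> nat \<Rightarrow> (nat \<Rightarrow> 'n \<times> real) \<Rightarrow> real^'n^'n" where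
  "lin_cocycle H 0 \<omega> = mat 1"
| "lin_cocycle H (Suc t) \<omega> = lin_step H ((shift ^^ t) \<omega>) ** lin_cocycle H t \<omega>"

text \<open>Real powers of a symmetric positive definite matrix by functional calculus: $A^p$ acts as
  $l^p$ on the eigenspace of $A$ for $l$.  As the eigenspaces span the whole space, the
  condition determines $A^p$ uniquely.\<close>

definition matrix_powr :: "real^'n^'n \<Rightarrow> real \<Rightarrow> real^'n^'n" where
  "matrix_powr A p = (THE B. \<forall>l. \<forall>v\<in>eigenspace A l. B *v v = (l powr p) *\<^sub>R v)"

definition lyapunov_seq :: "real^'n^'n \<Rightarrow> (nat \<Rightarrow> 'n \<times> real) \<Rightarrow> nat \<Rightarrow> real^'n^'n" where
  "lyapunov_seq H \<omega> t =
     matrix_powr (transpose (lin_cocycle H t \<omega>) ** lin_cocycle H t \<omega>) (1 / (2 * real t))"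

text \<open>The limit exists for almost every \<open>\<omega>\<close> by the multiplicative ergodic theorem.  On the
  exceptional null set, where the Lyapunov data are undefined, the identity matrix is used:
  it has no positive Lyapunov exponent, so \<open>W_plus\<close> is trivial there and no projection onto it
  is counted as nonzero.\<close>

definition lyapunov_matrix :: "real^'n^'n \<Rightarrow> (nat \<Rightarrow> 'n \<times> real) \<Rightarrow> real^'n^'n" where
  "lyapunov_matrix H \<omega> =
     (if convergent (lyapunov_seq H \<omega>) then lim (lyapunov_seq H \<omega>) else mat 1)"

definition lyapunov_exponents :: "real^'n^'n \<Rightarrow> (nat \<Rightarrow> 'n \<times> real) \<Rightarrow> real set" where
  "lyapunov_exponents H \<omega> = {l. exp l \<in> eigenvalues (lyapunov_matrix H \<omega>)}"

definition W_plus :: "real^'n^'n \<Rightarrow> (nat \<Rightarrow> 'n \<times> real) \<Rightarrow> (real^'n) set" where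
  "W_plus H \<omega> =
     span (\<Union>l\<in>{l \<in> lyapunov_exponents H \<omega>. l > 0}. eigenspace (lyapunov_matrix H \<omega>) (exp l))"

definition orth_proj :: "(real^'n) set \<Rightarrow> real^'n \<Rightarrow> real^'n" where
  "orth_proj W x = (THE y. y \<in> W \<and> (\<forall>w\<in>W. orthogonal (x - y) w))"

definition P_plus :: "real^'n^'n \<Rightarrow> (nat \<Rightarrow> 'n \<times> real) \<Rightarrow> real^'n \<Rightarrow> real^'n" where
  "P_plus H \<omega> = orth_proj (W_plus H \<omega>)"

end

theory Submission
  imports Defs
begin

text \<open>Fix a strict saddle point \<open>z\<close> with Hessian \<open>H\<close>, and let \<open>q(u) = u\<^sup>T H u / 2\<close>.  Since the step
  sizes are below \<open>1/M\<close>, the function \<open>f\<close> never increases along the iteration, and \<open>q\<close> never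
  increases along the linearized iteration.  Neither the multiplicative ergodic theorem nor growth rates
  are needed: the hypothesis on the projections enters only through the fact that the linearized orbit
  of \<open>e\<^sub>i\<close> is almost surely unbounded.

  If \<open>q\<close> stays nonnegative along all linearized orbits of \<open>u\<close>, then the expected decrease of \<open>q\<close>
  shows that the sum of the squared norms along the orbit has finite expectation, so the orbit is
  almost surely bounded.  Unboundedness of the orbits of the \<open>e\<^sub>i\<close> then forces some linearized
  orbit of every \<open>u \<noteq> 0\<close> to reach \<open>q < 0\<close>.  By scaling and compactness of the sphere there are
  \<open>n\<close> and \<open>p > 0\<close> such that from every point near \<open>z\<close> other than \<open>z\<close> the iteration reaches
  \<open>f < f z\<close> within \<open>n\<close> steps with probability at least \<open>p\<close>; it therefore almost surely does not remain
  near \<open>z\<close> with \<open>f \<ge> f z\<close>, as convergence to \<open>z\<close> would require.  Strict saddle points are isolated,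
  hence countable.\<close>

section \<open>Roots of positive semidefinite matrices\<close>

text \<open>The eigenvector \<open>e\<close> maximizes the quadratic form on the unit sphere of
  \<open>V\<close>, and \<open>l\<close> is the maximum. Moving from \<open>e\<close> in the
  direction of the residual \<open>w = T e - l e\<close> gains
  \<open>2 * t * (w \<bullet> w)\<close> to first order, which a term of order \<open>t^2\<close>
  cannot outweigh for small \<open>t > 0\<close> unless \<open>w = 0\<close>.\<close>

lemma selfadjoint_eigenvector_exists:
  fixes T :: "'a::euclidean_space \<Rightarrow> 'a"
  assumes lin: "linear T" and sa: "\<And>x y. T x \<bullet> y = x \<bullet> T y"
    and V: "subspace V" "T ` V \<subseteq> V" "V \<noteq> {0}"
  obtains e l where "e \<in> V" "norm e = 1" "T e = l *\<^sub>R e"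
proof -
  let ?K = "V \<inter> sphere 0 1"
  have "compact ?K" by (intro closed_Int_compact closed_subspace V compact_sphere)
  moreover have "?K \<noteq> {}"
  proof -
    obtain v where v: "v \<in> V" "v \<noteq> 0" using V(1,3) subspace_0 by blast
    then have "v /\<^sub>R norm v \<in> ?K" using V(1) by (auto simp: subspace_scale)
    then show ?thesis by blast
  qed
  moreover have "continuous_on ?K (\<lambda>x. T x \<bullet> x)"
    by (intro continuous_on_inner continuous_on_id linear_continuous_on) (simp add: lin linear_conv_bounded_linear[symmetric])
  ultimately obtain e where e: "e \<in> ?K" and max: "\<And>y. y \<in> ?K \<Longrightarrow> T y \<bullet> y \<le> T e \<bullet> e"
    using continuous_attains_sup[of ?K "\<lambda>x. T x \<bullet> x"] by blast
  define l where "l = T e \<bullet> e"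
  have ee: "e \<bullet> e = 1" using e by (simp add: norm_eq_sqrt_inner)
  have ray: "T y \<bullet> y \<le> l * (y \<bullet> y)" if "y \<in> V" for y
  proof (cases "y = 0")
    case True then show ?thesis using linear_0[OF lin] by simp
  next
    case False
    have "y /\<^sub>R norm y \<in> ?K" using that V(1) False by (auto simp: subspace_scale)
    from max[OF this] have "T y \<bullet> y / (norm y * norm y) \<le> l"
      by (simp add: linear_cmul[OF lin] l_def divide_inverse mult.commute mult.left_commute)
    then show ?thesis using False by (simp add: divide_le_eq power2_norm_eq_inner[symmetric] power2_eq_square)
  qed
  define w where "w = T e - l *\<^sub>R e"
  have wV: "w \<in> V" using e V by (auto simp: w_def subspace_diff subspace_scale)
  have key: "2 * t * (w \<bullet> w) \<le> t^2 * (l * (w \<bullet> w) - T w \<bullet> w)" for t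
  proof -
    have a1: "T (e + t *\<^sub>R w) \<bullet> (e + t *\<^sub>R w) \<le> l * ((e + t *\<^sub>R w) \<bullet> (e + t *\<^sub>R w))"
      using e wV V(1) by (intro ray) (auto simp: subspace_add subspace_scale)
    have a2: "T (e + t *\<^sub>R w) \<bullet> (e + t *\<^sub>R w) = l + 2 * t * (T e \<bullet> w) + t^2 * (T w \<bullet> w)"
      by (simp add: linear_add[OF lin] linear_cmul[OF lin] inner_add_left inner_add_right l_def
        sa[of w e] inner_commute[of w "T e"] power2_eq_square algebra_simps)
    have a3: "(e + t *\<^sub>R w) \<bullet> (e + t *\<^sub>R w) = 1 + 2 * t * (e \<bullet> w) + t^2 * (w \<bullet> w)"
      by (simp add: inner_add_left inner_add_right ee inner_commute[of w e] power2_eq_square algebra_simps)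
    have a4: "T e \<bullet> w = w \<bullet> w + l * (e \<bullet> w)"
      unfolding w_def by (simp add: inner_diff_left inner_diff_right algebra_simps)
    show ?thesis using a1 unfolding a2 a3 a4 by (simp add: algebra_simps)
  qed
  have "w \<bullet> w = 0"
  proof (rule ccontr)
    assume "w \<bullet> w \<noteq> 0"
    then have pos: "w \<bullet> w > 0" by simp
    \<comment> \<open>A positive bound on the coefficient of \<open>t^2\<close>. The choice
      \<open>t = w \<bullet> w / c\<close> then leaves twice a positive number below that number
      itself.\<close>
    define c where "c = max 1 (l * (w \<bullet> w) - T w \<bullet> w)"
    have c: "c \<ge> 1" "l * (w \<bullet> w) - T w \<bullet> w \<le> c" by (auto simp: c_def)
    have "2 * (w \<bullet> w / c) * (w \<bullet> w) \<le> (w \<bullet> w / c)^2 * c"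
      using key[of "w \<bullet> w / c"] mult_left_mono[OF c(2), of "(w \<bullet> w / c)^2"] by simp
    then have "2 * ((w \<bullet> w) * (w \<bullet> w) / c) \<le> (w \<bullet> w) * (w \<bullet> w) / c"
      using c(1) by (simp add: power2_eq_square)
    moreover have "(w \<bullet> w) * (w \<bullet> w) / c > 0" using pos c(1) by simp
    ultimately show False by linarith
  qed
  then show ?thesis using that[of e l] e by (auto simp: w_def)
qed

text \<open>Induction on the dimension: a unit eigenvector \<open>e\<close> is split off, and its
  orthogonal complement in \<open>V\<close> is again invariant because \<open>T\<close> is
  self-adjoint.\<close>

lemma selfadjoint_orthonormal_eigenbasis:
  fixes T :: "'a::euclidean_space \<Rightarrow> 'a"
  assumes lin: "linear T" and sa: "\<And>x y. T x \<bullet> y = x \<bullet> T y"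
    and V: "subspace V" "T ` V \<subseteq> V"
  shows "\<exists>B. finite B \<and> pairwise orthogonal B \<and> (\<forall>b\<in>B. norm b = 1 \<and> (\<exists>l. T b = l *\<^sub>R b)) \<and> span B = V"
  using V
proof (induction "dim V" arbitrary: V rule: less_induct)
  case less
  show ?case
  proof (cases "V = {0}")
    case True
    then show ?thesis by (intro exI[of _ "{}"]) auto
  next
    case False
    obtain e l where e: "e \<in> V" "norm e = 1" "T e = l *\<^sub>R e"
      using selfadjoint_eigenvector_exists[OF lin sa less.prems False] by blast
    have ee: "e \<bullet> e = 1" using e by (simp add: norm_eq_sqrt_inner)
    define U where "U = V \<inter> {x. e \<bullet> x = 0}"
    have U: "subspace U" unfolding U_def by (intro subspace_inter less.prems subspace_hyperplane)
    have TU: "T ` U \<subseteq> U"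
    proof
      fix y assume "y \<in> T ` U"
      then obtain x where x: "x \<in> V" "e \<bullet> x = 0" "y = T x" by (auto simp: U_def)
      then show "y \<in> U" using less.prems sa[of e x] e by (auto simp: U_def)
    qed
    have "e \<notin> U" using ee by (simp add: U_def)
    moreover have "U \<subseteq> V" by (simp add: U_def)
    ultimately have "U \<subset> V" using e(1) by blast
    then have "dim U < dim V" using dim_psubset[of U V] U less.prems by (simp only: span_eq_iff[THEN iffD2])
    then obtain B where B: "finite B" "pairwise orthogonal B"
        "\<forall>b\<in>B. norm b = 1 \<and> (\<exists>l. T b = l *\<^sub>R b)" "span B = U"
      using less.hyps[OF _ U TU] by blast
    have BU: "B \<subseteq> U" using B(4) span_superset by blast
    have "span (insert e B) = V"
    proof
      show "span (insert e B) \<subseteq> V"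
        using BU e(1) less.prems(1) by (intro span_minimal) (auto simp: U_def)
      show "V \<subseteq> span (insert e B)"
      proof
        fix v assume v: "v \<in> V"
        have "v - (e \<bullet> v) *\<^sub>R e \<in> U"
          using v e ee less.prems(1) by (auto simp: U_def subspace_diff subspace_scale inner_diff_right)
        then show "v \<in> span (insert e B)" using B(4) by (auto simp: span_breakdown_eq)
      qed
    qed
    moreover have "pairwise orthogonal (insert e B)"
      using B(2) BU by (auto simp: pairwise_insert U_def orthogonal_def inner_commute)
    ultimately show ?thesis using B e by (intro exI[of _ "insert e B"]) auto
  qed
qed

text \<open>The difference of the two sides is orthogonal to each element of \<open>B\<close> and
  lies in the span of \<open>B\<close>, hence is orthogonal to itself.\<close>

lemma sum_orthonormal_expansion:
  assumes "finite B" "pairwise orthogonal B" "\<forall>b\<in>B. norm b = 1" "x \<in> span B"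
  shows "(\<Sum>b\<in>B. (b \<bullet> x) *\<^sub>R b) = (x::'a::euclidean_space)"
proof (rule orthogonal_self[THEN iffD1, THEN eq_iff_diff_eq_0[THEN iffD2]])
  let ?d = "(\<Sum>b\<in>B. (b \<bullet> x) *\<^sub>R b) - x"
  have "orthogonal ?d c" if c: "c \<in> B" for c
  proof -
    have "(\<Sum>b\<in>B. (b \<bullet> x) * (b \<bullet> c)) = (\<Sum>b\<in>B. if b = c then c \<bullet> x else 0)"
      using assms(2,3) c
      by (intro sum.cong) (auto simp: pairwise_def orthogonal_def norm_eq_sqrt_inner)
    then show ?thesis using c assms(1)
      by (simp add: orthogonal_def inner_diff_left inner_sum_left inner_commute[of x c])
  qed
  moreover have "?d \<in> span B"
    by (intro span_diff span_sum span_scale assms(4)) (auto intro: span_base)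
  ultimately show "orthogonal ?d ?d" using orthogonal_to_span[of ?d B ?d] by blast
qed

lemma inner_orthonormal_expansion:
  assumes "finite B" "pairwise orthogonal B" "\<forall>b\<in>B. norm b = 1" "x \<in> span B"
  shows "x \<bullet> (y::'a::euclidean_space) = (\<Sum>b\<in>B. (b \<bullet> x) * (b \<bullet> y))"
  by (subst sum_orthonormal_expansion[OF assms, symmetric]) (simp add: inner_sum_left)

lemma inner_matrix_vector_transpose:
  "(A *v x) \<bullet> (y::real^'n) = x \<bullet> (transpose A *v y)"
  by (metis dot_lmul_matrix inner_commute transpose_matrix_vector transpose_transpose)

text \<open>Since \<open>matrix_powr\<close> is a definite description, existence and uniqueness
  have to be shown before it can be evaluated. The map \<open>Q\<close>, which rescales the
  coordinates in an eigenbasis, is a solution, and any solution is determined by its values on that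
  basis.\<close>

lemma matrix_powr_eigenbasis:
  fixes S :: "real^'n^'n"
  assumes "transpose S = S" and psd: "\<And>v. v \<bullet> (S *v v) \<ge> 0"
  obtains B L where "finite B" "pairwise orthogonal B" "\<forall>b\<in>B. norm b = 1" "span B = UNIV"
    "\<And>b. b \<in> B \<Longrightarrow> S *v b = L b *\<^sub>R b" "\<And>b. b \<in> B \<Longrightarrow> L b \<ge> 0"
    "\<And>b p. b \<in> B \<Longrightarrow> matrix_powr S p *v b = (L b powr p) *\<^sub>R b"
proof -
  obtain B where B: "finite B" "pairwise orthogonal B"
        "\<forall>b\<in>B. norm b = 1 \<and> (\<exists>l. S *v b = l *\<^sub>R b)" "span B = UNIV"
    using selfadjoint_orthonormal_eigenbasis[of "(*v) S" UNIV] inner_matrix_vector_transpose[of S] assms(1)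
    by auto
  then obtain L where L: "\<And>b. b \<in> B \<Longrightarrow> S *v b = L b *\<^sub>R b" by metis
  have B1: "\<forall>b\<in>B. norm b = 1" using B by blast
  note exp = sum_orthonormal_expansion[OF B(1,2) B1, unfolded B(4), OF UNIV_I]
  have Lpos: "L b \<ge> 0" if "b \<in> B" for b
    using psd[of b] L[OF that] B1 that by (simp add: norm_eq_sqrt_inner)
  have pw: "matrix_powr S p *v b = (L b powr p) *\<^sub>R b" if b: "b \<in> B" for b p
  proof -
    let ?P = "\<lambda>X. \<forall>l. \<forall>v\<in>eigenspace S l. X *v v = (l powr p) *\<^sub>R v"
    define Q where "Q v = (\<Sum>c\<in>B. (L c powr p * (c \<bullet> v)) *\<^sub>R c)" for v
    have linQ: "linear Q" unfolding Q_def
      by (intro linear_compose_sum ballI linearI) (auto simp: inner_add_right algebra_simps)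
    have "?P (matrix Q)"
    proof (intro allI ballI)
      fix l v assume "v \<in> eigenspace S l"
      then have v: "S *v v = l *\<^sub>R v" by (simp add: eigenspace_def)
      \<comment> \<open>By symmetry an eigenvector for \<open>l\<close> has zero coordinate along
        each basis vector whose eigenvalue differs from \<open>l\<close>.\<close>
      have "L c * (c \<bullet> v) = l * (c \<bullet> v)" if c: "c \<in> B" for c
        using inner_matrix_vector_transpose[of S c v] by (simp add: assms(1) L[OF c] v)
      then have "(L c powr p * (c \<bullet> v)) *\<^sub>R c = (l powr p) *\<^sub>R ((c \<bullet> v) *\<^sub>R c)" if "c \<in> B" for c
        using that by (cases "c \<bullet> v = 0") auto
      then have "Q v = (l powr p) *\<^sub>R (\<Sum>c\<in>B. (c \<bullet> v) *\<^sub>R c)"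
        unfolding Q_def scaleR_sum_right by (intro sum.cong refl)
      then show "matrix Q *v v = (l powr p) *\<^sub>R v" by (simp add: matrix_vector_mul(2)[OF linQ] exp)
    qed
    moreover have "X = matrix Q" if X: "?P X" for X
    proof (rule matrix_eq[THEN iffD2], intro allI)
      fix v
      have cX: "X *v c = matrix Q *v c" if "c \<in> B" for c
        using X[rule_format, of c "L c"] \<open>?P (matrix Q)\<close>[rule_format, of c "L c"] L[OF that]
        by (simp add: eigenspace_def)
      have "X *v (\<Sum>c\<in>B. (c \<bullet> v) *\<^sub>R c) = matrix Q *v (\<Sum>c\<in>B. (c \<bullet> v) *\<^sub>R c)"
        by (simp add: linear_sum cX vec.sum matrix_vector_mult_scaleR)
      then show "X *v v = matrix Q *v v" by (simp add: exp)
    qed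
    ultimately have "?P (matrix_powr S p)"
      unfolding matrix_powr_def by (rule theI)
    then show ?thesis using L[OF b] by (simp add: eigenspace_def)
  qed
  show ?thesis using that[OF B(1,2) B1 B(4) L Lpos pw] by blast
qed

text \<open>The left side is \<open>l\<close> to the power \<open>k / t\<close>, an exponent of at
  most one, and so is bounded by the larger of \<open>1\<close> and \<open>l\<close>.\<close>

lemma powr_root_power_le:
  fixes l :: real
  assumes "l \<ge> 0" "k \<le> t" "t > 0"
  shows "((l powr (1 / (2 * real t))) ^ k)^2 \<le> 1 + l"
proof (cases "l \<le> 1")
  case True
  then have "l powr (1 / (2 * real t)) \<le> 1"
    using assms(1) powr_mono2[of "1 / (2 * real t)" l 1] by simp
  then have "(l powr (1 / (2 * real t))) ^ k \<le> 1" by (intro power_le_one powr_ge_zero)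
  then have "((l powr (1 / (2 * real t))) ^ k)^2 \<le> 1" by (rule power_le_one[rotated]) simp
  then show ?thesis using assms(1) by linarith
next
  case False
  have "((l powr (1 / (2 * real t))) ^ k)^2 = l powr ((2 * real k) * (1 / (2 * real t)))"
    using False by (simp add: powr_power power_mult[symmetric] mult.commute del: One_nat_def)
  also have "\<dots> \<le> l powr 1" using False assms by (intro powr_mono) auto
  also have "\<dots> \<le> 1 + l" using False by simp
  finally show ?thesis .
qed

text \<open>In an eigenbasis of \<open>S\<close>, \<open>k\<close> applications of the root multiply
  each coordinate by a number whose square is at most one plus the eigenvalue. The resulting bound
  involves \<open>S\<close> itself and no root, so it is not lost when \<open>t\<close> tends to
  infinity.\<close>

lemma matrix_root_symmetric_bounded:
  fixes S :: "real^'n^'n"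
  assumes "transpose S = S" and psd: "\<And>v. v \<bullet> (S *v v) \<ge> 0"
  defines "R \<equiv> \<lambda>t. matrix_powr S (1 / (2 * real t))"
  shows "transpose (R t) = R t"
    and "k \<le> t \<Longrightarrow> t > 0 \<Longrightarrow> (norm ((((*v) (R t)) ^^ k) v))^2 \<le> v \<bullet> v + v \<bullet> (S *v v)"
proof -
  obtain B L where B: "finite B" "pairwise orthogonal B" "\<forall>b\<in>B. norm b = 1" "span B = UNIV"
    and L: "\<And>b. b \<in> B \<Longrightarrow> S *v b = L b *\<^sub>R b" "\<And>b. b \<in> B \<Longrightarrow> L b \<ge> 0"
    and P: "\<And>b p. b \<in> B \<Longrightarrow> matrix_powr S p *v b = (L b powr p) *\<^sub>R b"
    using matrix_powr_eigenbasis[OF assms(1,2)] by metis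
  note exp = sum_orthonormal_expansion[OF B(1-3), unfolded B(4), OF UNIV_I]
  note iexp = inner_orthonormal_expansion[OF B(1-3), unfolded B(4), OF UNIV_I]
  have orth: "(\<Sum>c\<in>B. g c * (b \<bullet> c)) = g b" if "b \<in> B" for b g
  proof -
    have "(\<Sum>c\<in>B. g c * (b \<bullet> c)) = (\<Sum>c\<in>B. if c = b then g b else 0)"
      using B(2,3) that
      by (intro sum.cong) (auto simp: pairwise_def orthogonal_def norm_eq_sqrt_inner)
    then show ?thesis using that B(1) by simp
  qed
  have coord: "b \<bullet> (R t *v x) = (L b powr (1 / (2 * real t))) * (b \<bullet> x)" if "b \<in> B" for b x t
  proof -
    have "R t *v x = (\<Sum>c\<in>B. ((c \<bullet> x) * L c powr (1 / (2 * real t))) *\<^sub>R c)"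
      by (subst exp[of x, symmetric])
        (simp add: P R_def vec.sum matrix_vector_mult_scaleR cong: sum.cong)
    then show ?thesis using orth[OF that, of "\<lambda>c. (c \<bullet> x) * L c powr (1 / (2 * real t))"]
      by (simp add: inner_sum_right mult.commute)
  qed
  have "(R t *v x) \<bullet> y = x \<bullet> (R t *v y)" for x y
    unfolding iexp[of "R t *v x" y] iexp[of x "R t *v y"] by (intro sum.cong) (auto simp: coord)
  then have "x \<bullet> (transpose (R t) *v y) = x \<bullet> (R t *v y)" for x y
    by (simp add: inner_matrix_vector_transpose)
  then have "transpose (R t) *v y = R t *v y" for y by (rule vector_eq_ldot[THEN iffD1, OF allI])
  then show "transpose (R t) = R t" by (simp add: matrix_eq)
  assume kt: "k \<le> t" "t > 0"
  have pc: "b \<bullet> ((((*v) (R t)) ^^ k) v) = (L b powr (1 / (2 * real t))) ^ k * (b \<bullet> v)" if "b \<in> B" for b k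
    by (induction k) (auto simp: coord that)
  have Sc: "b \<bullet> (S *v v) = L b * (b \<bullet> v)" if "b \<in> B" for b
    using inner_matrix_vector_transpose[of S b v] by (simp add: assms(1) L that)
  have "(norm ((((*v) (R t)) ^^ k) v))^2 = (\<Sum>b\<in>B. ((L b powr (1 / (2 * real t))) ^ k)^2 * (b \<bullet> v)^2)"
    unfolding power2_norm_eq_inner iexp[of "(((*v) (R t)) ^^ k) v"]
    by (intro sum.cong) (auto simp: pc power2_eq_square mult_ac)
  also have "\<dots> \<le> (\<Sum>b\<in>B. (1 + L b) * (b \<bullet> v)^2)"
    by (intro sum_mono mult_right_mono powr_root_power_le) (use kt L in auto)
  also have "\<dots> = v \<bullet> v + v \<bullet> (S *v v)"
    unfolding iexp[of v v] iexp[of v "S *v v"] sum.distrib[symmetric]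
    by (intro sum.cong) (auto simp: Sc power2_eq_square algebra_simps)
  finally show "(norm ((((*v) (R t)) ^^ k) v))^2 \<le> v \<bullet> v + v \<bullet> (S *v v)" .
qed

section \<open>The unstable subspace\<close>

lemma lyapunov_seq_symmetric_bounded:
  shows "transpose (lyapunov_seq H \<omega> t) = lyapunov_seq H \<omega> t"
    and "k \<le> t \<Longrightarrow> t > 0 \<Longrightarrow> (norm ((((*v) (lyapunov_seq H \<omega> t)) ^^ k) v))^2 \<le>
           (norm v)^2 + (norm (lin_cocycle H t \<omega> *v v))^2"
proof -
  let ?S = "transpose (lin_cocycle H t \<omega>) ** lin_cocycle H t \<omega>"
  have sym: "transpose ?S = ?S" by (simp add: matrix_transpose_mul)
  have quad: "v \<bullet> (?S *v v) = (norm (lin_cocycle H t \<omega> *v v))^2" for v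
    unfolding power2_norm_eq_inner
    by (simp add: inner_matrix_vector_transpose matrix_vector_mul_assoc)
  then have psd: "v \<bullet> (?S *v v) \<ge> 0" for v by simp
  show "transpose (lyapunov_seq H \<omega> t) = lyapunov_seq H \<omega> t"
    unfolding lyapunov_seq_def by (rule matrix_root_symmetric_bounded(1)[OF sym psd])
  show "k \<le> t \<Longrightarrow> t > 0 \<Longrightarrow> (norm ((((*v) (lyapunov_seq H \<omega> t)) ^^ k) v))^2 \<le>
           (norm v)^2 + (norm (lin_cocycle H t \<omega> *v v))^2"
    using matrix_root_symmetric_bounded(2)[OF sym psd, of k t v]
    unfolding lyapunov_seq_def quad power2_norm_eq_inner[of v] .
qed

lemma lyapunov_matrix_symmetric: "transpose (lyapunov_matrix H \<omega>) = lyapunov_matrix H \<omega>"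
proof (cases "convergent (lyapunov_seq H \<omega>)")
  case True
  then have lim: "lyapunov_seq H \<omega> \<longlonglongrightarrow> lyapunov_matrix H \<omega>"
    by (simp add: lyapunov_matrix_def convergent_LIMSEQ_iff)
  have "lyapunov_matrix H \<omega> $ j $ i = lyapunov_matrix H \<omega> $ i $ j" for i j
  proof (rule LIMSEQ_unique)
    show "(\<lambda>t. lyapunov_seq H \<omega> t $ i $ j) \<longlonglongrightarrow> lyapunov_matrix H \<omega> $ i $ j"
      by (intro tendsto_vec_nth lim)
    have "lyapunov_seq H \<omega> t $ i $ j = lyapunov_seq H \<omega> t $ j $ i" for t
      using arg_cong[OF lyapunov_seq_symmetric_bounded(1)[of H \<omega> t], of "\<lambda>X. X $ j $ i"]
      by (simp add: transpose_def)
    then show "(\<lambda>t. lyapunov_seq H \<omega> t $ i $ j) \<longlonglongrightarrow> lyapunov_matrix H \<omega> $ j $ i"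
      by (simp add: tendsto_vec_nth lim)
  qed
  then show ?thesis by (simp add: vec_eq_iff transpose_def)
qed (simp add: lyapunov_matrix_def)

lemma tendsto_matrix_vector_mult:
  fixes X :: "'b \<Rightarrow> real^'n^'m"
  assumes "(X \<longlongrightarrow> A) F" "(Y \<longlongrightarrow> y) F"
  shows "((\<lambda>t. X t *v Y t) \<longlongrightarrow> A *v y) F"
  unfolding matrix_vector_mult_def by (intro tendsto_intros assms)

text \<open>For fixed \<open>k\<close> the bounds on the \<open>k\<close>-th powers of the roots
  hold for all large \<open>t\<close> with the same constant, and so pass to the limit. If there is
  no limit, the Lyapunov matrix is the identity and the bound is trivial.\<close>

lemma lyapunov_matrix_powers_bounded:
  assumes bdd: "\<And>t. norm (lin_cocycle H t \<omega> *v v) \<le> C"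
  shows "(norm ((((*v) (lyapunov_matrix H \<omega>)) ^^ k) v))^2 \<le> (norm v)^2 + C^2"
proof (cases "convergent (lyapunov_seq H \<omega>)")
  case True
  then have lim: "lyapunov_seq H \<omega> \<longlonglongrightarrow> lyapunov_matrix H \<omega>"
    by (simp add: lyapunov_matrix_def convergent_LIMSEQ_iff)
  have "(\<lambda>t. (((*v) (lyapunov_seq H \<omega> t)) ^^ k) v) \<longlonglongrightarrow> (((*v) (lyapunov_matrix H \<omega>)) ^^ k) v"
    by (induction k) (auto intro!: tendsto_matrix_vector_mult lim)
  then have "(\<lambda>t. (norm ((((*v) (lyapunov_seq H \<omega> t)) ^^ k) v))^2)
      \<longlonglongrightarrow> (norm ((((*v) (lyapunov_matrix H \<omega>)) ^^ k) v))^2"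
    by (intro tendsto_intros)
  moreover have "(norm ((((*v) (lyapunov_seq H \<omega> t)) ^^ k) v))^2 \<le> (norm v)^2 + C^2"
    \<comment> \<open>\<open>Suc k\<close> rather than \<open>k\<close> also ensures
      \<open>t > 0\<close> when \<open>k = 0\<close>.\<close>
    if "t \<ge> Suc k" for t
    using lyapunov_seq_symmetric_bounded(2)[of k t H \<omega> v] that power_mono[OF bdd[of t], of 2] by simp
  ultimately show ?thesis by (intro LIMSEQ_le_const2) auto
next
  case False
  have "(((*v) (mat 1)) ^^ k) v = v" by (induction k) auto
  with False show ?thesis by (simp add: lyapunov_matrix_def)
qed

text \<open>Paired with an eigenvector for an exponent \<open>l > 0\<close>, the \<open>k\<close>-th power of the Lyapunov
  matrix applied to \<open>v\<close> grows like \<open>exp (k l)\<close>, unless \<open>v\<close> is orthogonal to that eigenvector.\<close>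

lemma P_plus_eq_0_if_bounded:
  assumes bdd: "\<And>t. norm (lin_cocycle H t \<omega> *v v) \<le> C"
  shows "P_plus H \<omega> v = 0"
proof -
  let ?L = "lyapunov_matrix H \<omega>"
  have ortho: "orthogonal v w" if w: "w \<in> eigenspace ?L (exp l)" and l: "l > 0" for w l
  proof (rule ccontr)
    assume "\<not> orthogonal v w"
    then have nz: "v \<bullet> w \<noteq> 0" by (simp add: orthogonal_def)
    have ev: "?L *v w = exp l *\<^sub>R w" using w by (simp add: eigenspace_def)
    have pw: "((((*v) ?L) ^^ k) v) \<bullet> w = exp l ^ k * (v \<bullet> w)" for k
      by (induction k)
        (auto simp: inner_matrix_vector_transpose[of ?L _ w] lyapunov_matrix_symmetric ev)
    define D where "D = sqrt ((norm v)^2 + C^2) * norm w"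
    have "exp l ^ k * \<bar>v \<bullet> w\<bar> \<le> D" for k
    proof -
      have "norm ((((*v) ?L) ^^ k) v) \<le> sqrt ((norm v)^2 + C^2)"
        using lyapunov_matrix_powers_bounded[of H \<omega> v C k, OF bdd] by (simp add: real_le_rsqrt)
      then have "norm ((((*v) ?L) ^^ k) v) * norm w \<le> D"
        unfolding D_def by (rule mult_right_mono) simp
      then show ?thesis
        using Cauchy_Schwarz_ineq2[of "(((*v) ?L) ^^ k) v" w] by (simp add: pw abs_mult)
    qed
    moreover obtain k where "D / \<bar>v \<bullet> w\<bar> < exp l ^ k"
      using real_arch_pow[of "exp l" "D / \<bar>v \<bullet> w\<bar>"] l by auto
    ultimately show False using nz by (simp add: divide_less_eq not_less[symmetric])
  qed
  have orthW: "orthogonal v w" if "w \<in> W_plus H \<omega>" for w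
    using that unfolding W_plus_def by (rule orthogonal_to_span) (use ortho in auto)
  have "0 \<in> W_plus H \<omega>" by (simp add: W_plus_def span_zero)
  \<comment> \<open>A candidate \<open>y\<close> for the projection is orthogonal to both
    \<open>v\<close> and \<open>v - y\<close>, hence to itself.\<close>
  moreover have "y = 0" if "y \<in> W_plus H \<omega>" "\<forall>w\<in>W_plus H \<omega>. orthogonal (v - y) w" for y
    using that(2)[rule_format, OF that(1)] orthW[OF that(1)]
    by (simp add: orthogonal_def inner_diff_left)
  ultimately show ?thesis unfolding P_plus_def orth_proj_def
    by (intro the_equality) (auto intro: orthW)
qed

section \<open>Coordinate steps\<close>

lemma coord_mat_mult: "coord_mat i *v x = (x $ i) *\<^sub>R axis i 1"
proof -
  have "(\<Sum>j\<in>UNIV. axis i 1 $ r * axis i 1 $ j * x $ j) = x $ i * (axis i 1 :: real^'a) $ r" for r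
  proof -
    have "(\<Sum>j\<in>UNIV. axis i 1 $ r * axis i 1 $ j * x $ j) =
      (\<Sum>j\<in>UNIV. if j = i then x $ i * (axis i 1 :: real^'a) $ r else 0)"
      by (intro sum.cong) (auto simp: axis_def)
    then show ?thesis by simp
  qed
  then show ?thesis by (simp add: coord_mat_def matrix_vector_mult_def vec_eq_iff)
qed

text \<open>The vector field \<open>F\<close> is a parameter, so that the gradient iteration and its
  linearization are instances of the same process.\<close>

definition coord_step :: "(real^'n \<Rightarrow> real^'n) \<Rightarrow> real^'n \<Rightarrow> 'n \<times> real \<Rightarrow> real^'n" where
  "coord_step F x s = x - (snd s * F x $ fst s) *\<^sub>R axis (fst s) 1"

primrec orbit :: "(real^'n \<Rightarrow> real^'n) \<Rightarrow> real^'n \<Rightarrow> (nat \<Rightarrow> 'n \<times> real) \<Rightarrow> nat \<Rightarrow> real^'n" where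
  "orbit F x \<omega> 0 = x"
| "orbit F x \<omega> (Suc t) = coord_step F (orbit F x \<omega> t) (\<omega> t)"

text \<open>The basis of all first-step arguments: prepending a step to the path amounts to moving
  the starting point.\<close>

lemma orbit_case_nat: "orbit F x (case_nat s \<omega>) (Suc t) = orbit F (coord_step F x s) \<omega> t"
  by (induction t) simp_all

lemma rcgd_eq_orbit: "rcgd f x \<omega> = orbit (grad f) x \<omega>"
proof
  show "rcgd f x \<omega> t = orbit (grad f) x \<omega> t" for t
    by (induction t) (simp_all add: coord_step_def coord_mat_mult)
qed

lemma shift_funpow: "(shift ^^ t) \<omega> = (\<lambda>k. \<omega> (k + t))"
  by (induction t arbitrary: \<omega>) (simp_all add: shift_def fun_eq_iff)

lemma lin_cocycle_eq_orbit: "lin_cocycle H t \<omega> *v u = orbit ((*v) H) u \<omega> t"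
proof (induction t)
  case (Suc t)
  then show ?case
    by (simp add: lin_step_def coord_step_def shift_funpow matrix_vector_mul_assoc[symmetric]
      matrix_vector_mult_diff_rdistrib scaleR_matrix_vector_assoc[symmetric] coord_mat_mult)
qed simp

definition qform :: "real^'n^'n \<Rightarrow> real^'n \<Rightarrow> real" where
  "qform H u = (u \<bullet> (H *v u)) / 2"

text \<open>An exact expansion, the form being quadratic along a line. Once
  \<open>a * H $ i $ i \<le> 1\<close> and \<open>a \<ge> 0\<close>, the decrease is at least
  \<open>a / 2\<close> times the squared partial derivative.\<close>

lemma qform_coord_step:
  assumes "transpose H = H"
  shows "qform H (coord_step ((*v) H) u (i, a)) = qform H u - a * (1 - a * H $ i $ i / 2) * ((H *v u) $ i)^2"
proof -
  define g where "g = (H *v u) $ i"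
  have *: "axis i 1 \<bullet> x = x $ i" for x :: "real^'a" by (simp add: inner_axis')
  have Hii: "axis i 1 \<bullet> (H *v axis i 1) = H $ i $ i"
    by (simp add: * matrix_vector_mult_basis column_def)
  have 1: "u \<bullet> (H *v axis i 1) = g"
    using inner_matrix_vector_transpose[of H u "axis i 1"] assms
    by (simp add: g_def inner_axis)
  have 2: "axis i 1 \<bullet> (H *v u) = g" by (simp add: * g_def)
  show ?thesis
    unfolding qform_def coord_step_def fst_conv snd_conv g_def[symmetric]
    by (simp add: matrix_vector_mult_diff_distrib matrix_vector_mult_scaleR inner_diff_left
        inner_diff_right 1 2 Hii power2_eq_square field_simps)
qed

section \<open>The distribution of a single step and of the path of steps\<close>

locale coord_steps =
  fixes a b :: real and M :: "('n::finite \<times> real) measure"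
  assumes a_less_b: "a < b" and M_eq: "M = step_space a b"
begin

abbreviation "step_size_distr \<equiv> uniform_measure (restrict_space lborel {a..b}) {a..b}"

lemma emeasure_interval: "emeasure (restrict_space lborel {a..b}) {a..b} = ennreal (b - a)"
  using a_less_b by (simp add: emeasure_restrict_space)

lemma prob_space_step_size_distr: "prob_space step_size_distr"
  using a_less_b by (intro prob_space_uniform_measure) (auto simp: emeasure_interval)

lemma prob_space_count: "prob_space (uniform_count_measure (UNIV :: 'n set))"
  by (rule prob_space_uniform_count_measure) auto

lemma prob_space_M: "prob_space M"
  unfolding M_eq step_space_def by (intro prob_space_pair prob_space_step_size_distr prob_space_count)

sublocale sequence_space M
  by (intro sequence_space.intro product_prob_spaceI prob_space_M)

lemma space_M: "space M = UNIV \<times> {a..b}"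
  by (simp add: M_eq step_space_def space_pair_measure space_uniform_count_measure space_restrict_space)

lemma measurable_fst_M [measurable]: "fst \<in> M \<rightarrow>\<^sub>M count_space UNIV"
  using measurable_fst[of "uniform_count_measure (UNIV :: 'n set)" step_size_distr]
  by (simp add: M_eq step_space_def measurable_cong_sets[OF refl sets_uniform_count_measure_count_space])

lemma measurable_snd_M [measurable]: "snd \<in> borel_measurable M"
proof -
  have "(\<lambda>x. x) \<in> borel_measurable step_size_distr"
    by (simp add: measurable_restrict_space1 cong: measurable_cong_sets)
  then show ?thesis unfolding M_eq step_space_def by (rule measurable_compose[OF measurable_snd])
qed

text \<open>Allows a prescribed step of the linearized iteration to be imitated, up to a small error
  in the step size, with positive probability.\<close>

lemma emeasure_rectangle_pos:
  assumes "\<alpha> \<in> {a..b}" "\<delta> > 0"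
  shows "{s \<in> space M. fst s = i \<and> \<bar>snd s - \<alpha>\<bar> < \<delta>} \<in> sets M"
    and "emeasure M {s \<in> space M. fst s = i \<and> \<bar>snd s - \<alpha>\<bar> < \<delta>} > 0"
proof -
  let ?I = "{\<alpha>-\<delta><..<\<alpha>+\<delta>} \<inter> {a..b}"
  show "{s \<in> space M. fst s = i \<and> \<bar>snd s - \<alpha>\<bar> < \<delta>} \<in> sets M" by measurable
  have eq: "{s \<in> space M. fst s = i \<and> \<bar>snd s - \<alpha>\<bar> < \<delta>} = {i} \<times> ?I"
    unfolding space_M abs_less_iff by auto
  have I: "?I \<in> sets (restrict_space lborel {a..b})" by (subst sets_restrict_space_iff) auto
  interpret U: prob_space step_size_distr by (rule prob_space_step_size_distr)
  \<comment> \<open>Clipping to the interval of step sizes leaves a nondegenerate interval even if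
    \<open>\<alpha>\<close> is one of its end points.\<close>
  define l u where "l = max a (\<alpha> - \<delta>)" and "u = min b (\<alpha> + \<delta>)"
  have "l < u" using assms a_less_b by (auto simp: l_def u_def)
  have "emeasure lborel {l<..<u} \<le> emeasure lborel ?I"
    by (intro emeasure_mono) (auto simp: l_def u_def)
  then have "emeasure lborel ?I > 0" using \<open>l < u\<close> by (simp add: less_le_trans[rotated])
  then have 1: "emeasure step_size_distr ?I > 0"
    using I a_less_b by (subst emeasure_uniform_measure)
      (auto simp: emeasure_interval emeasure_restrict_space ennreal_zero_less_divide Int_absorb1
        sets_restrict_space_iff)
  have 2: "emeasure (uniform_count_measure (UNIV :: 'n set)) {i} > 0"
    by (subst emeasure_uniform_count_measure) auto
  have "emeasure M ({i} \<times> ?I) = emeasure (uniform_count_measure UNIV) {i} * emeasure step_size_distr ?I"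
    unfolding M_eq step_space_def using I
    by (intro U.emeasure_pair_measure_Times) (auto simp: sets_uniform_count_measure)
  then show "emeasure M {s \<in> space M. fst s = i \<and> \<bar>snd s - \<alpha>\<bar> < \<delta>} > 0"
    using 1 2 by (simp add: eq ennreal_zero_less_mult_iff)
qed

lemma nn_integral_fst_M:
  assumes "\<And>i. \<phi> i \<ge> 0"
  shows "(\<integral>\<^sup>+s. ennreal (\<phi> (fst s)) \<partial>M) = ennreal ((\<Sum>i\<in>UNIV. \<phi> i) / real CARD('n))"
proof -
  interpret U: prob_space step_size_distr by (rule prob_space_step_size_distr)
  let ?C = "uniform_count_measure (UNIV :: 'n set)"
  have "(\<integral>\<^sup>+s. ennreal (\<phi> (fst s)) \<partial>M) = (\<integral>\<^sup>+i. (\<integral>\<^sup>+x. ennreal (\<phi> (fst (i, x))) \<partial>step_size_distr) \<partial>?C)"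
    unfolding M_eq step_space_def
    by (intro U.nn_integral_fst[symmetric] measurable_compose[OF measurable_fst])
       (simp add: measurable_cong_sets[OF sets_uniform_count_measure_count_space refl])
  also have "\<dots> = (\<integral>\<^sup>+i. ennreal (\<phi> i) \<partial>?C)"
    by (simp add: U.emeasure_space_1[simplified])
  also have "\<dots> = (\<Sum>i\<in>UNIV. ennreal (1 / real CARD('n)) * ennreal (\<phi> i))"
    unfolding uniform_count_measure_def by (subst nn_integral_point_measure_finite) auto
  also have "\<dots> = ennreal (\<Sum>i\<in>UNIV. (1 / real CARD('n)) * \<phi> i)"
    using assms by (simp add: ennreal_mult'[symmetric] sum_ennreal)
  finally show ?thesis by (simp add: sum_divide_distrib)
qed

text \<open>The path measure is the image of the product of \<open>M\<close> and \<open>S\<close>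
  under prepending, so Fubini's theorem separates the first step from the remaining path.\<close>

lemma nn_integral_path:
  assumes [measurable]: "g \<in> borel_measurable S"
  shows "(\<integral>\<^sup>+\<omega>. g \<omega> \<partial>S) = (\<integral>\<^sup>+s. (\<integral>\<^sup>+\<omega>. g (case_nat s \<omega>) \<partial>S) \<partial>M)"
proof -
  have "(\<integral>\<^sup>+\<omega>. g \<omega> \<partial>S) = (\<integral>\<^sup>+p. g ((\<lambda>(s, \<omega>). case_nat s \<omega>) p) \<partial>(M \<Otimes>\<^sub>M S))"
    by (subst PiM_iter[symmetric]) (simp add: nn_integral_distr)
  also have "\<dots> = (\<integral>\<^sup>+s. (\<integral>\<^sup>+\<omega>. g (case_nat s \<omega>) \<partial>S) \<partial>M)"
    by (subst P.nn_integral_fst[symmetric]) simp_all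
  finally show ?thesis .
qed

lemma case_nat_in_space: "s \<in> space M \<Longrightarrow> \<omega> \<in> space S \<Longrightarrow> case_nat s \<omega> \<in> space S"
  by (auto simp: space_PiM PiE_iff split: nat.split)

end

section \<open>Probabilities of staying in a set\<close>

locale coord_field = coord_steps a b M for a b and M :: "('n::finite \<times> real) measure" +
  fixes F :: "real^'n \<Rightarrow> real^'n"
  assumes F_cont: "continuous_on UNIV F"
begin

lemma measurable_F [measurable]: "F \<in> borel_measurable borel"
  by (rule borel_measurable_continuous_onI[OF F_cont])

text \<open>The random coordinate enters as an index with finitely many values, so it suffices to
  treat each fixed index.\<close>

lemma measurable_coord_step [measurable (raw)]:
  assumes [measurable]: "X \<in> borel_measurable N" "s \<in> N \<rightarrow>\<^sub>M M"
  shows "(\<lambda>y. coord_step F (X y) (s y)) \<in> borel_measurable N"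
proof -
  have "(\<lambda>y. (\<lambda>i. X y - (snd (s y) * F (X y) $ i) *\<^sub>R axis i 1) (fst (s y))) \<in> borel_measurable N"
  proof (rule measurable_compose_countable'[where I = UNIV and
      f = "\<lambda>i y. X y - (snd (s y) * F (X y) $ i) *\<^sub>R axis i 1"])
    fix i
    have "(\<lambda>v::real^'n. v $ i) \<in> borel_measurable borel"
      by (intro borel_measurable_continuous_onI continuous_intros)
    moreover have "(\<lambda>y. F (X y)) \<in> borel_measurable N" by measurable
    ultimately have [measurable]: "(\<lambda>y. F (X y) $ i) \<in> borel_measurable N"
      by (rule measurable_compose[rotated])
    show "(\<lambda>y. X y - (snd (s y) * F (X y) $ i) *\<^sub>R axis i 1) \<in> borel_measurable N" by measurable
  qed (auto intro: countable_finite)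
  then show ?thesis by (simp add: coord_step_def)
qed

lemma measurable_orbit [measurable]: "(\<lambda>\<omega>. orbit F x \<omega> t) \<in> borel_measurable S"
proof (induction t)
  case (Suc t)
  note [measurable] = Suc
  show ?case unfolding orbit.simps by measurable
qed simp

text \<open>The probability that the orbit of \<open>x\<close> is in \<open>G\<close> at the times
  \<open>0, ..., n - 1\<close>, written as a recursion over the first step;
  \<open>emeasure_orbit_stay\<close> identifies it with the probability on paths. Time
  \<open>n\<close> itself is not tested.\<close>

primrec stay :: "(real^'n) set \<Rightarrow> nat \<Rightarrow> real^'n \<Rightarrow> ennreal" where
  "stay G 0 x = 1"
| "stay G (Suc n) x = indicator G x * (\<integral>\<^sup>+s. stay G n (coord_step F x s) \<partial>M)"

lemma measurable_stay [measurable]: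
  assumes [measurable]: "G \<in> sets borel"
  shows "stay G n \<in> borel_measurable borel"
proof (induction n)
  case (Suc n)
  note [measurable] = Suc
  have "(\<lambda>x. \<integral>\<^sup>+s. stay G n (coord_step F x s) \<partial>M) \<in> borel_measurable borel"
    by measurable
  then show ?case unfolding stay.simps by measurable
qed simp

lemma stay_le_1: "stay G n x \<le> 1"
proof (induction n arbitrary: x)
  case (Suc n)
  have "(\<integral>\<^sup>+s. stay G n (coord_step F x s) \<partial>M) \<le> (\<integral>\<^sup>+s. 1 \<partial>M)"
    by (intro nn_integral_mono Suc)
  then show ?case by (simp add: M.emeasure_space_1 indicator_def)
qed simp

lemma stay_Suc_le: "stay G (Suc n) x \<le> stay G n x"
proof (induction n arbitrary: x)
  case 0
  show ?case using stay_le_1[of G 1 x] by simp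
next
  case (Suc n)
  have "(\<integral>\<^sup>+s. stay G (Suc n) (coord_step F x s) \<partial>M) \<le> (\<integral>\<^sup>+s. stay G n (coord_step F x s) \<partial>M)"
    by (intro nn_integral_mono Suc)
  then show ?case unfolding stay.simps(2)[of G "Suc n"] stay.simps(2)[of G n x] by (rule mult_left_mono) simp
qed

lemma stay_antimono: "m \<le> n \<Longrightarrow> stay G n x \<le> stay G m x"
  using decseqD[OF decseq_SucI[of "\<lambda>n. stay G n x", OF stay_Suc_le]] .

lemma stay_mono_set: "G \<subseteq> G' \<Longrightarrow> stay G n x \<le> stay G' n x"
proof (induction n arbitrary: x)
  case (Suc n)
  then show ?case unfolding stay.simps
    by (intro mult_mono nn_integral_mono) (auto split: split_indicator)
qed simp

text \<open>A form of the Markov property: wherever the first \<open>n\<close> steps lead, staying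
  for a further \<open>m\<close> times has probability at most \<open>c\<close>.\<close>

lemma stay_add_le:
  assumes [measurable]: "G \<in> sets borel" and c: "\<And>x. stay G m x \<le> c"
  shows "stay G (n + m) x \<le> c * stay G n x"
proof (induction n arbitrary: x)
  case 0
  show ?case using c by simp
next
  case (Suc n)
  have "(\<integral>\<^sup>+s. stay G (n + m) (coord_step F x s) \<partial>M) \<le> (\<integral>\<^sup>+s. c * stay G n (coord_step F x s) \<partial>M)"
    by (intro nn_integral_mono Suc)
  also have "\<dots> = c * (\<integral>\<^sup>+s. stay G n (coord_step F x s) \<partial>M)"
    by (intro nn_integral_cmult) measurable
  finally show ?case by (auto simp: indicator_def)
qed

lemma stay_mult_le:
  assumes "G \<in> sets borel" and "\<And>x. stay G m x \<le> c"
  shows "stay G (k * m) x \<le> c ^ k"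
proof (induction k arbitrary: x)
  case (Suc k)
  have "stay G (Suc k * m) x = stay G (k * m + m) x" by (simp add: add.commute)
  also have "\<dots> \<le> c * stay G (k * m) x" by (rule stay_add_le[OF assms])
  also have "\<dots> \<le> c * c ^ k" by (intro mult_left_mono Suc) simp
  finally show ?case by simp
qed simp

lemma emeasure_orbit_stay:
  assumes [measurable]: "G \<in> sets borel"
  shows "(\<integral>\<^sup>+\<omega>. indicator {\<omega>. \<forall>t<n. orbit F x \<omega> t \<in> G} \<omega> \<partial>S) = stay G n x"
proof (induction n arbitrary: x)
  case 0
  show ?case by (simp add: emeasure_space_1)
next
  case (Suc n)
  have m[measurable]: "(\<lambda>\<omega>. indicator {\<omega>. \<forall>t<n. orbit F x \<omega> t \<in> G} \<omega> :: ennreal) \<in> borel_measurable S" for n x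
    by measurable
  have "indicator {\<omega>. \<forall>t<Suc n. orbit F x \<omega> t \<in> G} (case_nat s \<omega>)
     = indicator G x * (indicator {\<omega>. \<forall>t<n. orbit F (coord_step F x s) \<omega> t \<in> G} \<omega> :: ennreal)" for s \<omega>
    unfolding indicator_def mem_Collect_eq All_less_Suc2 orbit_case_nat by simp
  then have "(\<integral>\<^sup>+\<omega>. indicator {\<omega>. \<forall>t<Suc n. orbit F x \<omega> t \<in> G} \<omega> \<partial>S) = (\<integral>\<^sup>+s. (\<integral>\<^sup>+\<omega>.
      indicator G x * (indicator {\<omega>. \<forall>t<n. orbit F (coord_step F x s) \<omega> t \<in> G} \<omega> :: ennreal) \<partial>S) \<partial>M)"
    by (subst nn_integral_path[OF m]) (simp only:)
  also have "\<dots> = (\<integral>\<^sup>+s. indicator G x * stay G n (coord_step F x s) \<partial>M)"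
    by (simp only: nn_integral_cmult[OF m] Suc)
  also have "\<dots> = stay G (Suc n) x"
    unfolding stay.simps by (intro nn_integral_cmult) measurable
  finally show ?case .
qed

text \<open>Staying from time 0 on forever means staying through any number of blocks of length
  \<open>m\<close>, so its probability is below every power of \<open>c\<close>. A later starting
  time is reduced to this one by conditioning on the first step.\<close>

lemma AE_eventually_leaves:
  assumes [measurable]: "G \<in> sets borel" and c: "\<And>x. stay G m x \<le> c" "c < 1"
  shows "AE \<omega> in S. \<not> (\<forall>t\<ge>k. orbit F x \<omega> t \<in> G)"
proof -
  have m[measurable]: "(\<lambda>\<omega>. indicator {\<omega>. \<forall>t\<ge>k. orbit F x \<omega> t \<in> G} \<omega> :: ennreal) \<in> borel_measurable S" for k x
    by measurable
  have "(\<integral>\<^sup>+\<omega>. indicator {\<omega>. \<forall>t\<ge>k. orbit F x \<omega> t \<in> G} \<omega> \<partial>S) = 0"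
  proof (induction k arbitrary: x)
    case 0
    \<comment> \<open>Here \<open>k\<close> is a fresh variable counting blocks of length
      \<open>m\<close>.\<close>
    have "(\<integral>\<^sup>+\<omega>. indicator {\<omega>. \<forall>t\<ge>0. orbit F x \<omega> t \<in> G} \<omega> \<partial>S) \<le> c ^ k" for k
    proof -
      have "(\<integral>\<^sup>+\<omega>. indicator {\<omega>. \<forall>t\<ge>0. orbit F x \<omega> t \<in> G} \<omega> \<partial>S)
          \<le> (\<integral>\<^sup>+\<omega>. indicator {\<omega>. \<forall>t<k*m. orbit F x \<omega> t \<in> G} \<omega> \<partial>S)"
        by (intro nn_integral_mono) (auto simp: indicator_def)
      also have "\<dots> \<le> c ^ k" unfolding emeasure_orbit_stay[OF assms(1)] by (rule stay_mult_le[OF assms(1) c(1)])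
      finally show ?thesis .
    qed
    moreover obtain r where r: "c = ennreal r" "r \<ge> 0" using c(2) by (cases c) auto
    then have "r < 1" using c(2) by (simp add: ennreal_less_one_iff)
    then have "(\<lambda>k. ennreal (r ^ k)) \<longlonglongrightarrow> ennreal 0"
      using r(2) by (intro tendsto_ennrealI LIMSEQ_realpow_zero)
    then have "(\<lambda>k. c ^ k) \<longlonglongrightarrow> 0" using r by (simp add: ennreal_power)
    ultimately show ?case
      using LIMSEQ_le_const[of "\<lambda>k. c ^ k" 0] by (metis (no_types, lifting) le_zero_eq)
  next
    case (Suc k)
    have "(\<forall>t\<ge>Suc k. P t) \<longleftrightarrow> (\<forall>t\<ge>k. P (Suc t))" for P
      by (metis Suc_le_D Suc_le_mono)
    then have "indicator {\<omega>. \<forall>t\<ge>Suc k. orbit F x \<omega> t \<in> G} (case_nat s \<omega>)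
     = (indicator {\<omega>. \<forall>t\<ge>k. orbit F (coord_step F x s) \<omega> t \<in> G} \<omega> :: ennreal)" for s \<omega>
      unfolding indicator_def mem_Collect_eq by (simp only: orbit_case_nat)
    then show ?case by (subst nn_integral_path[OF m]) (simp add: Suc)
  qed
  then have "AE \<omega> in S. indicator {\<omega>. \<forall>t\<ge>k. orbit F x \<omega> t \<in> G} \<omega> = (0::ennreal)"
    by (subst (asm) nn_integral_0_iff_AE[OF m])
  then show ?thesis by eventually_elim (auto simp: indicator_def)
qed

end

section \<open>The linearized iteration\<close>

lemma orbit_linear_diff: "orbit ((*v) H) (u - v) \<omega> t = orbit ((*v) H) u \<omega> t - orbit ((*v) H) v \<omega> t"
  by (simp add: lin_cocycle_eq_orbit[symmetric] matrix_vector_mult_diff_distrib)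

lemma orbit_linear_scaleR: "orbit ((*v) H) (c *\<^sub>R u) \<omega> t = c *\<^sub>R orbit ((*v) H) u \<omega> t"
  by (simp add: lin_cocycle_eq_orbit[symmetric] matrix_vector_mult_scaleR)

lemma (in coord_steps) coord_field_matrix: "coord_field a b M ((*v) H)"
  by unfold_locales (intro linear_continuous_on matrix_vector_mul_bounded_linear)

text \<open>In one step the expected decrease of \<open>qform\<close>, multiplied by the constant on
  the right, is at least the squared norm of the current point. The decreases telescope, and since
  the form stays nonnegative their total is bounded by its initial value. The induction on
  \<open>n\<close> applies the hypothesis after the first step.\<close>

lemma (in coord_steps) linear_energy_bound:
  fixes H :: "real^'n^'n"
  assumes sym: "transpose H = H" and a: "a > 0" and diag: "\<And>i. b * \<bar>H $ i $ i\<bar> \<le> 1"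
    and \<mu>: "\<mu> > 0" "\<And>v. \<mu> * norm v \<le> norm (H *v v)"
    and nonneg: "\<And>\<omega> t. \<omega> \<in> space S \<Longrightarrow> qform H (orbit ((*v) H) u \<omega> t) \<ge> 0"
  shows "(\<Sum>t<n. \<integral>\<^sup>+\<omega>. ennreal ((norm (orbit ((*v) H) u \<omega> t))\<^sup>2) \<partial>S)
    \<le> ennreal (2 * real CARD('n) / (a * \<mu>\<^sup>2) * qform H u)"
  using nonneg
proof (induction n arbitrary: u)
  case 0
  show ?case by simp
next
  case (Suc n)
  interpret coord_field a b M "(*v) H" by (rule coord_field_matrix)
  \<comment> \<open>Chosen so that the average over the coordinates of
    \<open>K * a / 2 * ((H *v u) $ i)^2\<close> is exactly the squared norm of \<open>H *v u\<close>
    divided by \<open>\<mu>^2\<close>.\<close>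
  define K where "K = 2 * real CARD('n) / (a * \<mu>\<^sup>2)"
  have K: "K > 0" using a \<mu> by (simp add: K_def)
  let ?o = "\<lambda>u \<omega> t. orbit ((*v) H) u \<omega> t" and ?s = "coord_step ((*v) H) u"
  have step_nonneg: "qform H (?o (?s s) \<omega> t) \<ge> 0" if "s \<in> space M" "\<omega> \<in> space S" for s \<omega> t
    using Suc.prems[OF case_nat_in_space[OF that], of "Suc t"] by (simp only: orbit_case_nat)
  obtain \<omega>0 where \<omega>0: "\<omega>0 \<in> space S" using not_empty by blast
  have step_le: "qform H (?s s) \<le> qform H u - a / 2 * ((H *v u) $ fst s)\<^sup>2" if "s \<in> space M" for s
  proof -
    define i \<alpha> where "i = fst s" and "\<alpha> = snd s"
    then have s: "s = (i, \<alpha>)" by simp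
    have \<alpha>: "a \<le> \<alpha>" "\<alpha> \<le> b" using that by (auto simp: space_M s)
    have "\<alpha> * H $ i $ i \<le> b * \<bar>H $ i $ i\<bar>"
      using \<alpha> a by (intro order_trans[OF mult_left_mono[OF abs_ge_self] mult_right_mono]) auto
    then have "1 / 2 \<le> 1 - \<alpha> * H $ i $ i / 2" using diag[of i] by simp
    then have "a * (1 / 2) \<le> \<alpha> * (1 - \<alpha> * H $ i $ i / 2)" using \<alpha> a by (intro mult_mono) auto
    then have "a * (1 / 2) * ((H *v u) $ i)\<^sup>2 \<le> \<alpha> * (1 - \<alpha> * H $ i $ i / 2) * ((H *v u) $ i)\<^sup>2"
      by (rule mult_right_mono) simp
    then show ?thesis unfolding s qform_coord_step[OF sym] by simp
  qed
  \<comment> \<open>Needed to average real numbers inside \<open>ennreal\<close>. The bound in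
    \<open>step_le\<close> depends only on the coordinate, so the single step size \<open>a\<close>
    suffices.\<close>
  have pos: "0 \<le> K * (qform H u - a / 2 * ((H *v u) $ i)\<^sup>2)" for i
  proof -
    have s: "(i, a) \<in> space M" using a_less_b by (simp add: space_M)
    show ?thesis using step_le[OF s] step_nonneg[OF s \<omega>0, of 0] K by simp
  qed
  have [measurable]: "(\<lambda>\<omega>. ennreal ((norm (?o u \<omega> t))\<^sup>2)) \<in> borel_measurable S" for u t by measurable
  have "(\<lambda>(s, \<omega>). ?o (?s s) \<omega> t) \<in> borel_measurable (M \<Otimes>\<^sub>M S)" for t
  proof -
    have "(\<lambda>p. ?o u (case_nat (fst p) (snd p)) (Suc t)) \<in> borel_measurable (M \<Otimes>\<^sub>M S)"
      by (rule measurable_compose[OF _ measurable_orbit]) measurable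
    then show ?thesis by (simp only: orbit_case_nat split_beta')
  qed
  note [measurable] = this
  have "(\<Sum>t<n. \<integral>\<^sup>+\<omega>. ennreal ((norm (?o u \<omega> (Suc t)))\<^sup>2) \<partial>S)
      = (\<Sum>t<n. \<integral>\<^sup>+s. (\<integral>\<^sup>+\<omega>. ennreal ((norm (?o (?s s) \<omega> t))\<^sup>2) \<partial>S) \<partial>M)"
    by (subst nn_integral_path) (simp_all only: orbit_case_nat, measurable)
  also have "\<dots> = (\<integral>\<^sup>+s. (\<Sum>t<n. \<integral>\<^sup>+\<omega>. ennreal ((norm (?o (?s s) \<omega> t))\<^sup>2) \<partial>S) \<partial>M)"
    by (rule nn_integral_sum[symmetric]) measurable
  also have "\<dots> \<le> (\<integral>\<^sup>+s. ennreal (K * (qform H u - a / 2 * ((H *v u) $ fst s)\<^sup>2)) \<partial>M)"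
  proof (rule nn_integral_mono)
    fix s assume s: "s \<in> space M"
    have "(\<Sum>t<n. \<integral>\<^sup>+\<omega>. ennreal ((norm (?o (?s s) \<omega> t))\<^sup>2) \<partial>S) \<le> ennreal (K * qform H (?s s))"
      unfolding K_def by (rule Suc.IH) (rule step_nonneg[OF s])
    also have "\<dots> \<le> ennreal (K * (qform H u - a / 2 * ((H *v u) $ fst s)\<^sup>2))"
      using step_le[OF s] K by (intro ennreal_leI mult_left_mono) auto
    finally show "(\<Sum>t<n. \<integral>\<^sup>+\<omega>. ennreal ((norm (?o (?s s) \<omega> t))\<^sup>2) \<partial>S)
       \<le> ennreal (K * (qform H u - a / 2 * ((H *v u) $ fst s)\<^sup>2))" .
  qed
  also have "\<dots> = ennreal ((\<Sum>i\<in>UNIV. K * (qform H u - a / 2 * ((H *v u) $ i)\<^sup>2)) / real CARD('n))"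
    by (rule nn_integral_fst_M[OF pos])
  also have "(\<Sum>i\<in>UNIV. K * (qform H u - a / 2 * ((H *v u) $ i)\<^sup>2)) / real CARD('n)
      = K * qform H u - (norm (H *v u))\<^sup>2 / \<mu>\<^sup>2"
  proof -
    have "(norm (H *v u))\<^sup>2 = (\<Sum>i\<in>UNIV. ((H *v u) $ i)\<^sup>2)"
      by (simp add: norm_vec_def L2_set_def sum_nonneg)
    moreover have "(\<Sum>i\<in>UNIV. K * (qform H u - a / 2 * ((H *v u) $ i)\<^sup>2))
       = real CARD('n) * (K * qform H u) - K * a / 2 * (\<Sum>i\<in>UNIV. ((H *v u) $ i)\<^sup>2)"
      by (simp add: right_diff_distrib sum_subtractf sum_distrib_left mult_ac)
    ultimately show ?thesis using a \<mu> by (simp add: K_def field_simps)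
  qed
  finally have rest: "(\<Sum>t<n. \<integral>\<^sup>+\<omega>. ennreal ((norm (?o u \<omega> (Suc t)))\<^sup>2) \<partial>S)
      \<le> ennreal (K * qform H u - (norm (H *v u))\<^sup>2 / \<mu>\<^sup>2)" .
  have norm_le: "(norm u)\<^sup>2 \<le> (norm (H *v u))\<^sup>2 / \<mu>\<^sup>2"
    using power_mono[OF \<mu>(2)[of u], of 2] \<mu>(1) by (simp add: field_simps power_mult_distrib)
  have qpos: "0 \<le> K * qform H u - (norm (H *v u))\<^sup>2 / \<mu>\<^sup>2"
    unfolding \<open>(\<Sum>i\<in>UNIV. _ i) / _ = _\<close>[symmetric] by (intro divide_nonneg_nonneg sum_nonneg pos) simp
  have "(\<Sum>t<Suc n. \<integral>\<^sup>+\<omega>. ennreal ((norm (?o u \<omega> t))\<^sup>2) \<partial>S) =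
      ennreal ((norm u)\<^sup>2) + (\<Sum>t<n. \<integral>\<^sup>+\<omega>. ennreal ((norm (?o u \<omega> (Suc t)))\<^sup>2) \<partial>S)"
    unfolding sum.lessThan_Suc_shift by (simp add: emeasure_space_1)
  also have "\<dots> \<le> ennreal ((norm (H *v u))\<^sup>2 / \<mu>\<^sup>2) + ennreal (K * qform H u - (norm (H *v u))\<^sup>2 / \<mu>\<^sup>2)"
    by (intro add_mono rest ennreal_leI norm_le)
  also have "\<dots> = ennreal (K * qform H u)"
    using qpos by (subst ennreal_plus[symmetric]) auto
  finally show ?case by (simp add: K_def)
qed

text \<open>The partial sums of the expected squared norms are bounded, so the random series of
  squared norms is almost surely finite, and its value bounds each term. The lower bound
  \<open>\<mu>\<close> comes from the injectivity of \<open>H\<close>.\<close>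

lemma (in coord_steps) linear_orbit_AE_bounded:
  fixes H :: "real^'n^'n"
  assumes sym: "transpose H = H" and a: "a > 0" and diag: "\<And>i. b * \<bar>H $ i $ i\<bar> \<le> 1"
    and nondeg: "\<And>v. H *v v = 0 \<Longrightarrow> v = 0"
    and nonneg: "\<And>\<omega> t. \<omega> \<in> space S \<Longrightarrow> qform H (orbit ((*v) H) u \<omega> t) \<ge> 0"
  shows "AE \<omega> in S. \<exists>C. \<forall>t. norm (orbit ((*v) H) u \<omega> t) \<le> C"
proof -
  interpret coord_field a b M "(*v) H" by (rule coord_field_matrix)
  have "inj ((*v) H)"
    using nondeg by (simp add: linear_injective_0[OF matrix_vector_mul_linear])
  then obtain \<mu> where \<mu>: "\<mu> > 0" "\<And>v. \<mu> * norm v \<le> norm (H *v v)"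
    using linear_inj_bounded_below_pos[OF matrix_vector_mul_linear] by metis
  let ?g = "\<lambda>t \<omega>. ennreal ((norm (orbit ((*v) H) u \<omega> t))\<^sup>2)"
  have [measurable]: "?g t \<in> borel_measurable S" for t by measurable
  have "(\<integral>\<^sup>+\<omega>. (\<Sum>t. ?g t \<omega>) \<partial>S) = (\<Sum>t. \<integral>\<^sup>+\<omega>. ?g t \<omega> \<partial>S)"
    by (rule nn_integral_suminf) measurable
  also have "\<dots> \<le> ennreal (2 * real CARD('n) / (a * \<mu>\<^sup>2) * qform H u)"
    using linear_energy_bound[OF sym a diag \<mu> nonneg] by (intro suminf_le_const) auto
  also have "\<dots> < \<infinity>" by simp
  finally have "AE \<omega> in S. (\<Sum>t. ?g t \<omega>) \<noteq> \<infinity>"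
    by (intro nn_integral_PInf_AE) auto
  then show ?thesis
  proof eventually_elim
    case (elim \<omega>)
    then obtain r where r: "(\<Sum>t. ?g t \<omega>) = ennreal r" "r \<ge> 0"
      by (metis ennreal_cases infinity_ennreal_def)
    have "norm (orbit ((*v) H) u \<omega> t) \<le> sqrt r" for t
    proof -
      have "sum (\<lambda>t. ?g t \<omega>) {t} \<le> (\<Sum>t. ?g t \<omega>)" by (rule sum_le_suminf[OF summableI]) simp_all
      then have "(norm (orbit ((*v) H) u \<omega> t))\<^sup>2 \<le> r" unfolding r(1) using r(2) by simp
      then show ?thesis by (rule real_le_rsqrt)
    qed
    then show ?case by blast
  qed
qed

text \<open>Otherwise the form stays nonnegative along the orbits of the two points reached from \<open>u\<close> by a
  step in a coordinate \<open>i\<close> with the extreme step sizes; both orbits are almost surely bounded, and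
  hence so is the orbit of \<open>e\<^sub>i\<close>, which is proportional to their difference.\<close>

lemma (in coord_steps) qform_negative_reachable:
  fixes H :: "real^'n^'n"
  assumes sym: "transpose H = H" and a: "a > 0" and diag: "\<And>i. b * \<bar>H $ i $ i\<bar> \<le> 1"
    and nondeg: "\<And>v. H *v v = 0 \<Longrightarrow> v = 0"
    and proj: "\<And>i. AE \<omega> in S. P_plus H \<omega> (axis i 1) \<noteq> 0"
    and u: "u \<noteq> 0"
  obtains \<omega> t where "\<omega> \<in> space S" "qform H (orbit ((*v) H) u \<omega> t) < 0"
proof (rule ccontr)
  assume "\<not> thesis"
  with that have nonneg: "qform H (orbit ((*v) H) u \<omega> t) \<ge> 0" if "\<omega> \<in> space S" for \<omega> t
    using \<open>\<omega> \<in> space S\<close> not_less by blast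
  have "H *v u \<noteq> 0" using nondeg u by blast
  then obtain i where i: "(H *v u) $ i \<noteq> 0" by (auto simp: vec_eq_iff)
  let ?s = "\<lambda>\<alpha>. coord_step ((*v) H) u (i, \<alpha>)"
  have bdd: "AE \<omega> in S. \<exists>C. \<forall>t. norm (orbit ((*v) H) (?s \<alpha>) \<omega> t) \<le> C" if \<alpha>: "\<alpha> \<in> {a..b}" for \<alpha>
  proof (rule linear_orbit_AE_bounded[OF sym a diag nondeg])
    fix \<omega> t assume \<omega>: "\<omega> \<in> space S"
    have "(i, \<alpha>) \<in> space M" using \<alpha> by (simp add: space_M)
    from nonneg[OF case_nat_in_space[OF this \<omega>], of "Suc t"]
    show "qform H (orbit ((*v) H) (?s \<alpha>) \<omega> t) \<ge> 0" by (simp only: orbit_case_nat)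
  qed
  have "a \<in> {a..b}" "b \<in> {a..b}" using a_less_b by auto
  from bdd[OF this(1)] bdd[OF this(2)] proj[of i] have "AE \<omega> in S. False"
  proof (eventually_elim)
    case (elim \<omega>)
    define c where "c = (b - a) * (H *v u) $ i"
    have c: "c \<noteq> 0" using i a_less_b by (simp add: c_def)
    have "?s a - ?s b = c *\<^sub>R axis i 1" by (simp add: coord_step_def c_def algebra_simps)
    then have e: "axis i 1 = (1 / c) *\<^sub>R (?s a - ?s b)" using c by simp
    obtain A B where AB: "\<And>t. norm (orbit ((*v) H) (?s a) \<omega> t) \<le> A"
        "\<And>t. norm (orbit ((*v) H) (?s b) \<omega> t) \<le> B"
      using elim(1,2) by blast
    have "norm (lin_cocycle H t \<omega> *v axis i 1) \<le> \<bar>1 / c\<bar> * (A + B)" for t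
    proof -
      have "norm (lin_cocycle H t \<omega> *v axis i 1)
          = \<bar>1 / c\<bar> * norm (orbit ((*v) H) (?s a) \<omega> t - orbit ((*v) H) (?s b) \<omega> t)"
        unfolding lin_cocycle_eq_orbit e orbit_linear_scaleR orbit_linear_diff by simp
      also have "\<dots> \<le> \<bar>1 / c\<bar> * (A + B)"
        using order_trans[OF norm_triangle_ineq4 add_mono[OF AB(1)[of t] AB(2)[of t]]]
        by (rule mult_left_mono) simp
      finally show ?thesis .
    qed
    then have "P_plus H \<omega> (axis i 1) = 0" by (rule P_plus_eq_0_if_bounded)
    with elim(3) show False by simp
  qed
  then show False by simp
qed

section \<open>Functions with bounded Hessian\<close>

lemma has_derivative_grad:
  assumes "f differentiable (at x)"
  shows "(f has_derivative (\<lambda>h. grad f x \<bullet> h)) (at x)"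
proof -
  let ?D = "frechet_derivative f (at x)"
  have D: "(f has_derivative ?D) (at x)" using assms by (simp add: frechet_derivative_works)
  then have lin: "linear ?D" by (rule has_derivative_linear)
  have "?D h = grad f x \<bullet> h" for h
  proof -
    have "?D h = ?D (\<Sum>i\<in>UNIV. (h $ i) *\<^sub>R axis i 1)"
      using basis_expansion[of h] by (simp add: scalar_mult_eq_scaleR)
    also have "\<dots> = (\<Sum>i\<in>UNIV. h $ i * ?D (axis i 1))"
      by (simp add: linear_sum[OF lin] linear_cmul[OF lin])
    finally show ?thesis by (simp add: grad_def inner_vec_def mult.commute)
  qed
  then have "?D = (\<lambda>h. grad f x \<bullet> h)" by blast
  with D show ?thesis by simp
qed

locale C2_function =
  fixes f :: "real^'n \<Rightarrow> real" and L :: real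
  assumes C2: "C2 f"
    and L_pos: "L > 0"
    and hessian_bound: "\<And>x. onorm (\<lambda>v. hessian f x *v v) \<le> L"
begin

lemma f_deriv: "(f has_derivative (\<lambda>h. grad f x \<bullet> h)) (at x)"
  using C2 by (intro has_derivative_grad) (simp add: C2_def)

lemma grad_deriv: "(grad f has_derivative (\<lambda>h. hessian f x *v h)) (at x)"
  using C2 unfolding hessian_def C2_def jacobian_works by blast

lemma f_cont: "continuous_on UNIV f"
  using f_deriv has_derivative_continuous by (metis continuous_at_imp_continuous_on)

lemma grad_cont: "continuous_on UNIV (grad f)"
  using grad_deriv has_derivative_continuous by (metis continuous_at_imp_continuous_on)

lemma f_deriv_line: "((\<lambda>t. f (x + t *\<^sub>R w)) has_real_derivative (grad f (x + t *\<^sub>R w) \<bullet> w)) (at t)"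
proof -
  have "((\<lambda>t. x + t *\<^sub>R w) has_derivative (\<lambda>h. h *\<^sub>R w)) (at t)"
    by (auto intro!: derivative_eq_intros)
  from has_derivative_compose[OF this f_deriv]
  show ?thesis by (simp add: has_field_derivative_def mult_commute_abs)
qed

lemma grad_lipschitz: "norm (grad f x - grad f y) \<le> L * norm (x - y)"
  by (rule differentiable_bound[of UNIV "grad f" "\<lambda>x h. hessian f x *v h"])
     (auto intro: grad_deriv hessian_bound)

text \<open>By the Lipschitz bound on the gradient, the partial derivative in direction
  \<open>i\<close> changes along the step by no more than its initial modulus, and so never takes
  the opposite sign.\<close>

lemma coord_step_nonincreasing:
  assumes "0 \<le> \<alpha>" "\<alpha> * L \<le> 1"
  shows "f (coord_step (grad f) x (i, \<alpha>)) \<le> f x"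
proof -
  define d where "d = grad f x $ i"
  let ?w = "- d *\<^sub>R axis i 1 :: real^'n"
  have "f (x + \<alpha> *\<^sub>R ?w) \<le> f (x + 0 *\<^sub>R ?w)"
  proof (rule DERIV_nonpos_imp_nonincreasing[OF assms(1)])
    fix s assume s: "0 \<le> s" "s \<le> \<alpha>"
    define y where "y = grad f (x + s *\<^sub>R ?w) $ i"
    have "\<bar>y - d\<bar> \<le> norm (grad f (x + s *\<^sub>R ?w) - grad f x)"
      unfolding y_def d_def by (metis component_le_norm_cart vector_minus_component)
    also have "\<dots> \<le> L * norm (s *\<^sub>R ?w)" using grad_lipschitz[of "x + s *\<^sub>R ?w" x] by simp
    also have "\<dots> = (s * L) * \<bar>d\<bar>" using s by (simp add: abs_mult)
    also have "\<dots> \<le> 1 * \<bar>d\<bar>"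
      using s assms(2) L_pos by (intro mult_right_mono) (auto intro: order_trans[OF mult_right_mono])
    finally have "\<bar>y - d\<bar> \<le> \<bar>d\<bar>" by simp
    then have "0 \<le> d * y" by (auto simp: abs_if zero_le_mult_iff split: if_splits)
    then have "grad f (x + s *\<^sub>R ?w) \<bullet> ?w \<le> 0" by (simp add: y_def inner_axis)
    then show "\<exists>y. ((\<lambda>t. f (x + t *\<^sub>R ?w)) has_real_derivative y) (at s) \<and> y \<le> 0"
      using f_deriv_line by blast
  qed
  then show ?thesis by (simp add: coord_step_def d_def)
qed

text \<open>To land on \<open>z\<close>, the step would need length \<open>norm (x - z)\<close>, but
  its length is at most \<open>\<alpha> * L * norm (x - z)\<close>, which is smaller. Hence an orbit
  cannot reach \<open>z\<close> in finite time.\<close>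

lemma coord_step_neq_critical:
  assumes crit: "grad f z = 0" and "0 \<le> \<alpha>" "\<alpha> * L < 1" "x \<noteq> z"
  shows "coord_step (grad f) x (i, \<alpha>) \<noteq> z"
proof
  assume "coord_step (grad f) x (i, \<alpha>) = z"
  then have "x - z = (\<alpha> * grad f x $ i) *\<^sub>R axis i 1" by (auto simp: coord_step_def)
  then have "norm (x - z) = \<alpha> * \<bar>grad f x $ i\<bar>" using assms(2) by (simp add: abs_mult)
  also have "\<dots> \<le> \<alpha> * (L * norm (x - z))"
    using grad_lipschitz[of x z] component_le_norm_cart[of "grad f x" i] assms(1,2)
    by (intro mult_left_mono) auto
  also have "\<dots> < norm (x - z)" using assms(3,4) by (simp add: mult.assoc[symmetric])
  finally show False by simp
qed

end

section \<open>Local expansions at a critical point\<close>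

locale critical_point = C2_function f L for f :: "real^'n \<Rightarrow> real" and L +
  fixes z :: "real^'n"
  assumes critical: "grad f z = 0"
begin

abbreviation "H \<equiv> hessian f z"

lemma grad_approx:
  assumes "\<epsilon> > 0"
  obtains \<delta> where "\<delta> > 0" "\<And>h. norm h < \<delta> \<Longrightarrow> norm (grad f (z + h) - H *v h) \<le> \<epsilon> * norm h"
proof -
  obtain \<delta> where "\<delta> > 0" and
    *: "\<And>y. norm (y - z) < \<delta> \<Longrightarrow> norm (grad f y - grad f z - H *v (y - z)) \<le> \<epsilon> * norm (y - z)"
    using grad_deriv[of z, unfolded has_derivative_at_alt] assms by blast
  then show ?thesis using that[of \<delta>] *[of "z + _"] critical by simp
qed

text \<open>The mean value theorem is applied along \<open>w\<close> to \<open>f\<close> minus its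
  quadratic model; the derivative of this difference is the linearization error of the gradient
  paired with \<open>w\<close>. Taking \<open>u = 0\<close> gives the Taylor expansion, and general
  \<open>u\<close> serves the symmetry of the Hessian.\<close>

lemma increment_approx:
  assumes "\<epsilon> > 0"
  obtains \<delta> where "\<delta> > 0"
    "\<And>u w. norm u + norm w < \<delta> \<Longrightarrow>
      \<bar>f (z + u + w) - f (z + u) - (H *v u) \<bullet> w - qform H w\<bar> \<le> \<epsilon> * (norm u + norm w) * norm w"
proof -
  obtain \<delta> where \<delta>: "\<delta> > 0" "\<And>h. norm h < \<delta> \<Longrightarrow> norm (grad f (z + h) - H *v h) \<le> \<epsilon> * norm h"
    using grad_approx[OF assms] by blast
  have "\<bar>f (z + u + w) - f (z + u) - (H *v u) \<bullet> w - qform H w\<bar> \<le> \<epsilon> * (norm u + norm w) * norm w"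
    if uw: "norm u + norm w < \<delta>" for u w
  proof -
    let ?h = "\<lambda>t. f (z + u + t *\<^sub>R w) - t * ((H *v u) \<bullet> w) - t^2 * qform H w"
    have "\<exists>t>0. t < 1 \<and> ?h 1 - ?h 0 = (1 - 0) *
        (grad f (z + u + t *\<^sub>R w) \<bullet> w - (H *v u) \<bullet> w - 2 * t * qform H w)"
      by (rule MVT2) (auto intro!: derivative_eq_intros f_deriv_line)
    then obtain t where t: "0 < t" "t < 1"
      and eq: "?h 1 - ?h 0 = grad f (z + (u + t *\<^sub>R w)) \<bullet> w - (H *v u) \<bullet> w - 2 * t * qform H w"
      by (auto simp: add.assoc)
    have "?h 1 - ?h 0 = (grad f (z + (u + t *\<^sub>R w)) - H *v (u + t *\<^sub>R w)) \<bullet> w"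
      unfolding eq by (simp add: qform_def inner_diff_left inner_add_left matrix_vector_right_distrib
        matrix_vector_mult_scaleR inner_commute[of w])
    also have "\<bar>\<dots>\<bar> \<le> norm (grad f (z + (u + t *\<^sub>R w)) - H *v (u + t *\<^sub>R w)) * norm w"
      by (rule Cauchy_Schwarz_ineq2)
    also have "\<dots> \<le> \<epsilon> * (norm u + norm w) * norm w"
    proof (rule mult_right_mono)
      have "norm (u + t *\<^sub>R w) \<le> norm u + t * norm w" using norm_triangle_ineq[of u "t *\<^sub>R w"] t by simp
      also have "\<dots> \<le> norm u + norm w" using t by (simp add: mult_left_le_one_le)
      finally have le: "norm (u + t *\<^sub>R w) \<le> norm u + norm w" .
      then have "norm (grad f (z + (u + t *\<^sub>R w)) - H *v (u + t *\<^sub>R w)) \<le> \<epsilon> * norm (u + t *\<^sub>R w)"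
        using uw by (intro \<delta>(2)) simp
      also have "\<dots> \<le> \<epsilon> * (norm u + norm w)" using le assms by (intro mult_left_mono) auto
      finally show "norm (grad f (z + (u + t *\<^sub>R w)) - H *v (u + t *\<^sub>R w)) \<le> \<epsilon> * (norm u + norm w)" .
    qed simp
    finally show ?thesis by (simp add: algebra_simps)
  qed
  with \<delta>(1) show ?thesis using that by blast
qed

lemma taylor_quadratic:
  assumes "\<epsilon> > 0"
  obtains \<delta> where "\<delta> > 0" "\<And>w. norm w < \<delta> \<Longrightarrow> \<bar>f (z + w) - f z - qform H w\<bar> \<le> \<epsilon> * (norm w)^2"
proof -
  obtain \<delta> where \<delta>: "\<delta> > 0" "\<And>u w. norm u + norm w < \<delta> \<Longrightarrow>
      \<bar>f (z + u + w) - f (z + u) - (H *v u) \<bullet> w - qform H w\<bar> \<le> \<epsilon> * (norm u + norm w) * norm w"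
    using increment_approx[OF assms] by blast
  show ?thesis using that[OF \<delta>(1)] \<delta>(2)[of 0] by (simp add: power2_eq_square mult.assoc)
qed

lemma qform_scaleR: "qform A (s *\<^sub>R u) = s^2 * qform A u"
  by (simp add: qform_def matrix_vector_mult_scaleR power2_eq_square)

text \<open>The increment of \<open>f\<close> from \<open>z\<close> to \<open>z + s u + s w\<close> is computed along both edges of the
  parallelogram.\<close>

lemma hessian_symmetric: "transpose H = H"
proof -
  have "(H *v u) \<bullet> w = (H *v w) \<bullet> u" for u w
  proof -
    define N where "N = norm u + norm w"
    have N: "N \<ge> 0" "norm u \<le> N" "norm w \<le> N" by (auto simp: N_def)
    have bound: "\<bar>(H *v u) \<bullet> w - (H *v w) \<bullet> u\<bar> \<le> \<epsilon> * (4 * N^2)" if \<epsilon>: "\<epsilon> > 0" for \<epsilon>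
    proof -
      obtain \<delta> where \<delta>: "\<delta> > 0" "\<And>u w. norm u + norm w < \<delta> \<Longrightarrow>
          \<bar>f (z + u + w) - f (z + u) - (H *v u) \<bullet> w - qform H w\<bar> \<le> \<epsilon> * (norm u + norm w) * norm w"
        using increment_approx[OF \<epsilon>] by blast
      define s where "s = \<delta> / (2 * (N + 1))"
      have s: "s > 0" "s * N < \<delta>" using \<delta>(1) N(1) by (auto simp: s_def field_simps add_nonneg_pos)
      have est: "\<bar>f (z + s *\<^sub>R x + s *\<^sub>R y) - f (z + s *\<^sub>R x) - s^2 * ((H *v x) \<bullet> y) - s^2 * qform H y\<bar>
          \<le> s^2 * (\<epsilon> * N^2)" if xy: "norm x + norm y \<le> N" for x y
      proof -
        have "norm (s *\<^sub>R x) + norm (s *\<^sub>R y) = s * (norm x + norm y)" using s by (simp add: distrib_left)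
        also have le: "\<dots> \<le> s * N" using xy s by (intro mult_left_mono) auto
        finally have "norm (s *\<^sub>R x) + norm (s *\<^sub>R y) < \<delta>" using s by simp
        from \<delta>(2)[OF this]
        have "\<bar>f (z + s *\<^sub>R x + s *\<^sub>R y) - f (z + s *\<^sub>R x) - s^2 * ((H *v x) \<bullet> y) - s^2 * qform H y\<bar>
          \<le> \<epsilon> * (s * norm x + s * norm y) * (s * norm y)"
          using s by (simp add: qform_scaleR matrix_vector_mult_scaleR power2_eq_square mult_ac)
        also have "\<dots> \<le> \<epsilon> * (s * N) * (s * N)"
        proof -
          have "norm y \<le> N" using xy norm_ge_zero[of x] by linarith
          then show ?thesis using le s \<epsilon> N by (intro mult_mono) (auto simp: distrib_left)
        qed
        finally show ?thesis by (simp add: power2_eq_square mult_ac)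
      qed
      have "s^2 * \<bar>(H *v u) \<bullet> w - (H *v w) \<bullet> u\<bar> = \<bar>s^2 * ((H *v u) \<bullet> w) - s^2 * ((H *v w) \<bullet> u)\<bar>"
        by (simp add: abs_mult right_diff_distrib[symmetric])
      also have "\<dots> \<le> 4 * (s^2 * (\<epsilon> * N^2))"
        \<comment> \<open>Two estimates for each of the two routes to the opposite corner. In their
          difference all values of \<open>f\<close> and both \<open>qform\<close> terms
          cancel.\<close>
        using est[of u w] est[of 0 u] est[of w u] est[of 0 w] N
        by (simp add: N_def add.commute add.left_commute)
      finally have "s^2 * \<bar>(H *v u) \<bullet> w - (H *v w) \<bullet> u\<bar> \<le> s^2 * (\<epsilon> * (4 * N^2))" by (simp add: mult_ac)
      then show ?thesis using s by simp
    qed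
    have "\<bar>(H *v u) \<bullet> w - (H *v w) \<bullet> u\<bar> \<le> 0"
    proof (rule field_le_epsilon)
      fix e :: real assume "e > 0"
      \<comment> \<open>The added \<open>1\<close> keeps the denominator positive when
        \<open>N = 0\<close>.\<close>
      have "\<bar>(H *v u) \<bullet> w - (H *v w) \<bullet> u\<bar> \<le> e / (4 * N^2 + 1) * (4 * N^2)"
        using \<open>e > 0\<close> by (intro bound) (simp add: add_nonneg_pos)
      also have "\<dots> \<le> e" using \<open>e > 0\<close> by (simp add: divide_le_eq add_nonneg_pos mult_left_mono)
      finally show "\<bar>(H *v u) \<bullet> w - (H *v w) \<bullet> u\<bar> \<le> 0 + e" by simp
    qed
    then show ?thesis by simp
  qed
  then have "u \<bullet> (transpose H *v w) = u \<bullet> (H *v w)" for u w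
    by (metis inner_matrix_vector_transpose inner_commute)
  then have "transpose H *v w = H *v w" for w by (rule vector_eq_ldot[THEN iffD1, OF allI])
  then show ?thesis by (simp add: matrix_eq)
qed

lemma hessian_diag_le: "\<bar>H $ i $ i\<bar> \<le> L"
proof -
  have "\<bar>H $ i $ i\<bar> = \<bar>(H *v axis i 1) $ i\<bar>" by (simp add: matrix_vector_mult_basis column_def)
  also have "\<dots> \<le> norm (H *v axis i 1)" by (rule component_le_norm_cart)
  also have "\<dots> \<le> onorm (\<lambda>v. H *v v) * norm (axis i 1 :: real^'n)"
    by (rule onorm[OF matrix_vector_mul_bounded_linear])
  also have "\<dots> \<le> L" using hessian_bound by simp
  finally show ?thesis .
qed

text \<open>Near \<open>z\<close> the gradient differs from \<open>H *v (y - z)\<close> by at most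
  half of the lower bound \<open>\<mu> * norm (y - z)\<close> for the norm of the latter.\<close>

lemma critical_isolated:
  assumes "\<And>v. H *v v = 0 \<Longrightarrow> v = 0"
  shows "\<exists>\<delta>>0. \<forall>y. y \<noteq> z \<longrightarrow> dist y z < \<delta> \<longrightarrow> grad f y \<noteq> 0"
proof -
  have "inj ((*v) H)"
    using assms by (simp add: linear_injective_0[OF matrix_vector_mul_linear])
  then obtain \<mu> where \<mu>: "\<mu> > 0" "\<And>v. \<mu> * norm v \<le> norm (H *v v)"
    using linear_inj_bounded_below_pos[OF matrix_vector_mul_linear] by metis
  have "\<mu> / 2 > 0" using \<mu> by simp
  from grad_approx[OF this] obtain \<delta> where \<delta>: "\<delta> > 0"
    "\<And>h. norm h < \<delta> \<Longrightarrow> norm (grad f (z + h) - H *v h) \<le> \<mu> / 2 * norm h" by blast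
  have "grad f y \<noteq> 0" if "y \<noteq> z" "dist y z < \<delta>" for y
  proof
    assume "grad f y = 0"
    then have "norm (H *v (y - z)) \<le> \<mu> / 2 * norm (y - z)"
      using \<delta>(2)[of "y - z"] that by (simp add: dist_norm norm_minus_commute)
    with \<mu>(2)[of "y - z"] have "\<mu> * norm (y - z) \<le> \<mu> / 2 * norm (y - z)" by linarith
    then show False using \<mu>(1) that by simp
  qed
  with \<delta>(1) show ?thesis by blast
qed

end

section \<open>Escape from a critical point\<close>

locale rcgd_critical = critical_point f L z + coord_steps a b M
  for f :: "real^'n \<Rightarrow> real" and L z a b and M :: "('n \<times> real) measure" +
  assumes a_pos: "a > 0" and b_small: "b * L < 1"
begin

sublocale coord_field a b M "grad f"
  by unfold_locales (rule grad_cont)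

lemma step_size:
  assumes "s \<in> space M"
  obtains i \<alpha> where "s = (i, \<alpha>)" "0 \<le> \<alpha>" "\<alpha> \<le> b" "\<alpha> * L < 1"
proof -
  have s: "0 \<le> snd s" "snd s \<le> b" using assms a_pos by (auto simp: space_M)
  then have "snd s * L < 1" using mult_right_mono[OF s(2), of L] L_pos b_small by linarith
  with s show ?thesis using that[of "fst s" "snd s"] by simp
qed

abbreviation "G0 \<equiv> {x. f x \<ge> f z}"

text \<open>The exit probability is bounded below on a truncated cone around the ray from \<open>z\<close> in direction
  \<open>v\<close>.  This form is inherited backwards along the linearized steps, and finitely many such cones
  cover a punctured ball around \<open>z\<close>.\<close>

definition escapes :: "real^'n \<Rightarrow> bool" where
  "escapes v \<longleftrightarrow> (\<exists>n p \<delta>. 0 < p \<and> p \<le> 1 \<and> 0 < \<delta> \<and>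
     (\<forall>x s. 0 < s \<longrightarrow> s < \<delta> \<longrightarrow> norm (x - z - s *\<^sub>R v) \<le> \<delta> * s \<longrightarrow> stay G0 n x \<le> ennreal (1 - p)))"

text \<open>Close to \<open>z\<close>, the sign of \<open>f x - f z\<close> in a narrow cone around
  \<open>v\<close> is that of \<open>qform H v\<close>. The points of the truncated cone thus lie
  outside \<open>G0\<close> already at time 0, which is all that \<open>stay G0 1\<close>
  tests.\<close>

lemma escapes_if_qform_negative:
  assumes v: "qform H v < 0"
  shows "escapes v"
proof -
  define c where "c = - qform H v / 2"
  have c: "c > 0" using v by (simp add: c_def)
  have "continuous_on UNIV (qform H)"
    unfolding qform_def by (intro continuous_intros linear_continuous_on matrix_vector_mul_bounded_linear) simp
  then obtain \<delta>1 where \<delta>1: "\<delta>1 > 0" "\<And>y. dist y v < \<delta>1 \<Longrightarrow> dist (qform H y) (qform H v) < c"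
    using c by (metis UNIV_I continuous_on_iff)
  \<comment> \<open>For directions \<open>y\<close> in the cone, \<open>qform H y < - c\<close>,
    while this \<open>\<epsilon>\<close> keeps the Taylor error, divided by \<open>s^2\<close>,
    below \<open>c\<close>.\<close>
  define \<epsilon> where "\<epsilon> = c / (2 * (norm v + 1)^2)"
  have nv: "norm v + 1 > 0" by (simp add: add_nonneg_pos)
  then have nv2: "(norm v + 1)^2 > 0" by simp
  have "\<epsilon> > 0" unfolding \<epsilon>_def using c nv2 by (intro divide_pos_pos) auto
  moreover have "\<epsilon> * (norm v + 1)^2 = c / 2" unfolding \<epsilon>_def using nv2 by simp
  ultimately have \<epsilon>: "\<epsilon> > 0" "\<epsilon> * (norm v + 1)^2 < c" using c by simp_all
  obtain \<delta>2 where \<delta>2: "\<delta>2 > 0" "\<And>w. norm w < \<delta>2 \<Longrightarrow> \<bar>f (z + w) - f z - qform H w\<bar> \<le> \<epsilon> * (norm w)^2"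
    using taylor_quadratic[OF \<epsilon>(1)] by blast
  define \<delta> where "\<delta> = min (min 1 (\<delta>1 / 2)) (\<delta>2 / (norm v + 1))"
  have "\<delta> \<le> 1" "\<delta> \<le> \<delta>1 / 2" "\<delta> \<le> \<delta>2 / (norm v + 1)" unfolding \<delta>_def by linarith+
  then have \<delta>: "\<delta> > 0" "\<delta> \<le> 1" "\<delta> < \<delta>1" "\<delta> * (norm v + 1) \<le> \<delta>2"
    using \<delta>1(1) \<delta>2(1) nv by (auto simp: \<delta>_def pos_le_divide_eq[OF nv, symmetric])
  have "stay G0 1 x \<le> ennreal (1 - 1)"
    if s: "0 < s" "s < \<delta>" and x: "norm (x - z - s *\<^sub>R v) \<le> \<delta> * s" for x s
  proof -
    define y where "y = (1 / s) *\<^sub>R (x - z)"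
    have w: "x - z = s *\<^sub>R y" using s by (simp add: y_def)
    have "norm (s *\<^sub>R (y - v)) \<le> \<delta> * s" using x by (simp add: w scaleR_diff_right)
    then have yv: "norm (y - v) \<le> \<delta>" using s by simp
    then have "norm y \<le> norm v + 1" using norm_triangle_sub[of y v] \<delta>(2) by linarith
    then have ny: "(norm y)^2 \<le> (norm v + 1)^2" "s * norm y \<le> s * (norm v + 1)" 
      using s by (auto intro: power_mono)
    have "s * (norm v + 1) < \<delta> * (norm v + 1)" using s nv by simp
    then have "s * norm y < \<delta>2" using ny(2) \<delta>(4) by linarith
    then have "norm (s *\<^sub>R y) < \<delta>2" using s by simp
    from \<delta>2(2)[OF this] have "f x - f z \<le> qform H (s *\<^sub>R y) + \<epsilon> * (norm (s *\<^sub>R y))^2"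
      by (simp add: w[symmetric])
    also have "\<dots> = s^2 * (qform H y + \<epsilon> * (norm y)^2)"
      by (simp add: qform_scaleR power_mult_distrib distrib_left)
    also have "\<dots> < 0"
    proof -
      have "qform H y < - c" using \<delta>1(2)[of y] yv \<delta>(3) by (simp add: dist_norm c_def)
      moreover have "\<epsilon> * (norm y)^2 \<le> \<epsilon> * (norm v + 1)^2" using ny(1) \<epsilon>(1) by simp
      ultimately have "qform H y + \<epsilon> * (norm y)^2 < 0" using \<epsilon>(2) by linarith
      then show ?thesis using s by (simp add: mult_pos_neg)
    qed
    finally show ?thesis by simp
  qed
  with \<delta>(1) show ?thesis unfolding escapes_def by (intro exI[of _ 1] exI[of _ \<delta>]) auto
qed

text \<open>The first step is split according to membership in \<open>E\<close>; outside
  \<open>E\<close> the trivial bound one is used.\<close>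

lemma stay_Suc_le_const:
  assumes E: "E \<in> sets M" and p: "0 < p" "p \<le> 1"
    and le: "\<And>s. s \<in> E \<Longrightarrow> stay G n (coord_step (grad f) x s) \<le> ennreal (1 - p)"
  shows "stay G (Suc n) x \<le> ennreal (1 - p * M.prob E)"
proof -
  have "stay G (Suc n) x \<le> (\<integral>\<^sup>+s. stay G n (coord_step (grad f) x s) \<partial>M)"
    by (simp add: indicator_def)
  also have "\<dots> \<le> (\<integral>\<^sup>+s. ennreal (1 - p) * indicator E s + 1 * indicator (space M - E) s \<partial>M)"
    by (intro nn_integral_mono) (auto simp: le stay_le_1 indicator_def)
  also have "\<dots> = ennreal (1 - p) * emeasure M E + emeasure M (space M - E)"
    using E by (subst nn_integral_add) (auto simp: nn_integral_cmult_indicator)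
  also have "\<dots> = ennreal ((1 - p) * M.prob E + (1 - M.prob E))"
    using p E by (subst ennreal_plus) (auto simp: M.emeasure_eq_measure M.prob_compl ennreal_mult)
  finally show ?thesis by (simp add: algebra_simps)
qed

text \<open>If the first step uses coordinate \<open>i\<close> and a size within
  \<open>\<eta>\<close> of \<open>\<alpha>\<close>, the nonlinear step carries a narrow cone around
  \<open>v\<close> into the given cone around the next linearized point at the same scale
  \<open>s\<close>. Four errors of at most \<open>\<delta> / 4 * s\<close> each add up: the initial
  offset, its effect on the gradient (where \<open>\<beta> * L \<le> 1\<close> enters), the
  linearization and the step size. The escape probability is multiplied by that of such a first
  step.\<close>

lemma escapes_step:
  assumes \<alpha>: "\<alpha> \<in> {a..b}" and esc: "escapes (coord_step ((*v) H) v (i, \<alpha>))"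
  shows "escapes v"
proof -
  let ?v' = "coord_step ((*v) H) v (i, \<alpha>)"
  obtain n p \<delta> where p: "0 < p" "p \<le> 1" and \<delta>: "0 < \<delta>" and
    *: "\<And>x s. 0 < s \<Longrightarrow> s < \<delta> \<Longrightarrow> norm (x - z - s *\<^sub>R ?v') \<le> \<delta> * s \<Longrightarrow> stay G0 n x \<le> ennreal (1 - p)"
    using esc unfolding escapes_def by blast
  have b: "b > 0" using a_pos a_less_b by simp
  define \<epsilon> where "\<epsilon> = \<delta> / (4 * b * (norm v + 1))"
  have nv: "norm v + 1 > 0" by (simp add: add_nonneg_pos)
  have \<epsilon>: "\<epsilon> > 0" using \<delta> b nv by (simp add: \<epsilon>_def)
  have \<epsilon>2: "b * (\<epsilon> * norm v) \<le> \<delta> / 4"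
  proof -
    have "b * (\<delta> / (4 * b * m) * k) = \<delta> / 4 * (k / m)" if "m > 0" for k m
      using b that by (simp add: field_simps)
    from this[OF nv, of "norm v"] have "b * (\<epsilon> * norm v) = \<delta> / 4 * (norm v / (norm v + 1))"
      unfolding \<epsilon>_def .
    also have "\<dots> \<le> \<delta> / 4 * 1" using \<delta> nv by (intro mult_left_mono) auto
    finally show ?thesis by simp
  qed
  obtain \<delta>2 where \<delta>2: "\<delta>2 > 0" "\<And>h. norm h < \<delta>2 \<Longrightarrow> norm (grad f (z + h) - H *v h) \<le> \<epsilon> * norm h"
    using grad_approx[OF \<epsilon>] by blast
  define \<eta> where "\<eta> = \<delta> / (4 * (norm (H *v v) + 1))"
  have nHv: "norm (H *v v) + 1 > 0" by (simp add: add_nonneg_pos)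
  have \<eta>: "\<eta> > 0" using \<delta> nHv by (simp add: \<eta>_def)
  have \<eta>2: "\<eta> * norm (H *v v) \<le> \<delta> / 4"
  proof -
    have "\<eta> * norm (H *v v) = \<delta> / 4 * (norm (H *v v) / (norm (H *v v) + 1))"
      by (simp add: \<eta>_def)
    also have "\<dots> \<le> \<delta> / 4 * 1" using \<delta> nHv by (intro mult_left_mono) auto
    finally show ?thesis by simp
  qed
  \<comment> \<open>The first bound controls both contributions of the offset; the second keeps
    \<open>s *\<^sub>R v\<close> where the linearization estimate is valid.\<close>
  define \<delta>' where "\<delta>' = min (\<delta> / 4) (\<delta>2 / (norm v + 1))"
  have "\<delta>' \<le> \<delta> / 4" "\<delta>' \<le> \<delta>2 / (norm v + 1)" unfolding \<delta>'_def by linarith+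
  then have \<delta>': "\<delta>' > 0" "\<delta>' \<le> \<delta> / 4" "\<delta>' * (norm v + 1) \<le> \<delta>2"
    using \<delta> \<delta>2(1) nv by (auto simp: \<delta>'_def pos_le_divide_eq[OF nv, symmetric])
  define E where "E = {s \<in> space M. fst s = i \<and> \<bar>snd s - \<alpha>\<bar> < \<eta>}"
  have E: "E \<in> sets M" "emeasure M E > 0"
    using emeasure_rectangle_pos[OF \<alpha> \<eta>, of i] by (simp_all add: E_def)
  define e where "e = M.prob E"
  have e: "0 < e" "e \<le> 1" using E(2) by (auto simp: e_def M.emeasure_eq_measure)
  have "stay G0 (Suc n) x \<le> ennreal (1 - p * e)"
    if s: "0 < s" "s < \<delta>'" and x: "norm (x - z - s *\<^sub>R v) \<le> \<delta>' * s" for x s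
    unfolding e_def
  proof (rule stay_Suc_le_const[OF E(1) p])
    fix \<sigma> assume \<sigma>: "\<sigma> \<in> E"
    define \<beta> where "\<beta> = snd \<sigma>"
    have \<sigma>_eq: "\<sigma> = (i, \<beta>)" using \<sigma> by (auto simp: E_def \<beta>_def prod_eq_iff)
    have \<beta>: "0 \<le> \<beta>" "\<beta> \<le> b" "\<bar>\<beta> - \<alpha>\<bar> < \<eta>" "\<beta> * L \<le> 1"
    proof -
      have "\<sigma> \<in> space M" using \<sigma> by (simp add: E_def)
      then show "0 \<le> \<beta>" "\<beta> \<le> b" "\<beta> * L \<le> 1"
        by (rule step_size, simp add: \<beta>_def)+
      show "\<bar>\<beta> - \<alpha>\<bar> < \<eta>" using \<sigma> by (simp add: E_def \<beta>_def)
    qed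
    define g where "g = grad f x $ i"
    define h where "h = (H *v v) $ i"
    have "s * norm v \<le> s * (norm v + 1)" using s by simp
    also have "\<dots> < \<delta>' * (norm v + 1)" using s nv by simp
    finally have "norm (s *\<^sub>R v) < \<delta>2" using \<delta>'(3) s by simp
    from \<delta>2(2)[OF this] have g1: "norm (grad f (z + s *\<^sub>R v) - s *\<^sub>R (H *v v)) \<le> \<epsilon> * (s * norm v)"
      using s by (simp add: matrix_vector_mult_scaleR)
    have g2: "norm (grad f x - grad f (z + s *\<^sub>R v)) \<le> L * (\<delta>' * s)"
    proof (rule order_trans[OF grad_lipschitz mult_left_mono])
      show "norm (x - (z + s *\<^sub>R v)) \<le> \<delta>' * s" using x by (simp add: diff_diff_eq)
    qed (use L_pos in simp)
    have "\<bar>g - s * h\<bar> \<le> norm (grad f x - s *\<^sub>R (H *v v))"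
      using component_le_norm_cart[of "grad f x - s *\<^sub>R (H *v v)" i] by (simp add: g_def h_def)
    also have "\<dots> \<le> L * (\<delta>' * s) + \<epsilon> * (s * norm v)"
      using norm_triangle_mono[OF g2 g1] by simp
    finally have "\<beta> * \<bar>g - s * h\<bar> \<le> \<beta> * (L * (\<delta>' * s) + \<epsilon> * (s * norm v))"
      using \<beta>(1) by (rule mult_left_mono)
    also have "\<dots> = (\<beta> * L) * (\<delta>' * s) + s * (\<beta> * (\<epsilon> * norm v))" by (simp add: algebra_simps)
    also have "\<dots> \<le> 1 * (\<delta>' * s) + s * (\<delta> / 4)"
    proof (intro add_mono mult_right_mono mult_left_mono)
      have "\<beta> * (\<epsilon> * norm v) \<le> b * (\<epsilon> * norm v)" using \<beta>(2) \<epsilon> by (intro mult_right_mono) auto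
      then show "\<beta> * (\<epsilon> * norm v) \<le> \<delta> / 4" using \<epsilon>2 by linarith
    qed (use \<beta> s \<delta>' in auto)
    finally have t1: "\<beta> * \<bar>g - s * h\<bar> \<le> \<delta>' * s + s * (\<delta> / 4)" by simp
    have "\<bar>\<beta> - \<alpha>\<bar> * \<bar>h\<bar> \<le> \<eta> * norm (H *v v)"
      using \<beta>(3) \<eta> component_le_norm_cart[of "H *v v" i] unfolding h_def by (intro mult_mono) auto
    then have t2: "s * (\<bar>\<beta> - \<alpha>\<bar> * \<bar>h\<bar>) \<le> s * (\<delta> / 4)" using \<eta>2 s by (intro mult_left_mono) auto
    have "\<beta> * g - s * (\<alpha> * h) = \<beta> * (g - s * h) + s * ((\<beta> - \<alpha>) * h)" by (simp add: algebra_simps)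
    then have "\<bar>\<beta> * g - s * (\<alpha> * h)\<bar> \<le> \<beta> * \<bar>g - s * h\<bar> + s * (\<bar>\<beta> - \<alpha>\<bar> * \<bar>h\<bar>)"
      using abs_triangle_ineq[of "\<beta> * (g - s * h)" "s * ((\<beta> - \<alpha>) * h)"] s \<beta>(1) by (simp add: abs_mult)
    with t1 t2 have t: "\<bar>\<beta> * g - s * (\<alpha> * h)\<bar> \<le> \<delta>' * s + s * (\<delta> / 2)" by simp
    have "coord_step (grad f) x \<sigma> - z - s *\<^sub>R ?v' =
        (x - z - s *\<^sub>R v) - (\<beta> * g - s * (\<alpha> * h)) *\<^sub>R axis i 1"
      by (simp add: coord_step_def \<sigma>_eq g_def h_def algebra_simps)
    also have "norm \<dots> \<le> norm (x - z - s *\<^sub>R v) + norm ((\<beta> * g - s * (\<alpha> * h)) *\<^sub>R (axis i 1 :: real^'n))"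
      by (rule norm_triangle_ineq4)
    also have "\<dots> \<le> \<delta>' * s + (\<delta>' * s + s * (\<delta> / 2))" using x t by simp
    also have "\<dots> = 2 * (\<delta>' * s) + \<delta> * s / 2" by (simp add: algebra_simps)
    also have "\<dots> \<le> 2 * (\<delta> / 4 * s) + \<delta> * s / 2"
      using mult_right_mono[OF \<delta>'(2) less_imp_le[OF s(1)]] by (intro add_mono mult_left_mono) auto
    also have "\<dots> = \<delta> * s" by simp
    finally show "stay G0 n (coord_step (grad f) x \<sigma>) \<le> ennreal (1 - p)"
      using s \<delta>'(2) \<delta> by (intro *[of s]) auto
  qed
  moreover have "0 < p * e" "p * e \<le> 1" using p e by (auto simp: mult_le_one)
  ultimately show ?thesis using \<delta>'(1) unfolding escapes_def by blast
qed

lemma escapes_orbit: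
  assumes \<omega>: "\<omega> \<in> space S" and neg: "qform H (orbit ((*v) H) v \<omega> t) < 0"
  shows "escapes v"
proof -
  have "escapes (orbit ((*v) H) v \<omega> t) \<Longrightarrow> escapes v"
  proof (induction t)
    case (Suc t)
    have "\<omega> t \<in> space M" using \<omega> by (auto simp: space_PiM)
    then have "snd (\<omega> t) \<in> {a..b}" by (auto simp: space_M)
    then show ?case using Suc escapes_step[of "snd (\<omega> t)" _ "fst (\<omega> t)"] by simp
  qed simp
  then show ?thesis using escapes_if_qform_negative[OF neg] by blast
qed

text \<open>Finitely many of the balls of radius \<open>\<delta> v\<close> cover the unit sphere, so
  each nearby \<open>x\<close> other than \<open>z\<close> lies in one of finitely many cones at
  scale \<open>s = norm (x - z)\<close>. The largest time works for all of them because
  \<open>stay\<close> decreases in \<open>n\<close>.\<close>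

lemma uniform_escape:
  assumes esc: "\<And>v. v \<noteq> 0 \<Longrightarrow> escapes v"
  shows "\<exists>n r c. r > 0 \<and> c < 1 \<and> (\<forall>x. x \<noteq> z \<longrightarrow> norm (x - z) < r \<longrightarrow> stay G0 n x \<le> c)"
proof -
  have "\<forall>v\<in>sphere 0 1. \<exists>n p \<delta>. 0 < p \<and> p \<le> 1 \<and> 0 < \<delta> \<and>
     (\<forall>x s. 0 < s \<longrightarrow> s < \<delta> \<longrightarrow> norm (x - z - s *\<^sub>R v) \<le> \<delta> * s \<longrightarrow> stay G0 n x \<le> ennreal (1 - p))"
    using esc unfolding escapes_def by (metis norm_zero mem_sphere_0 zero_neq_one)
  then obtain n p \<delta> where *: "\<And>v. v \<in> sphere 0 1 \<Longrightarrow> 0 < p v \<and> p v \<le> 1 \<and> 0 < \<delta> v \<and>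
     (\<forall>x s. 0 < s \<longrightarrow> s < \<delta> v \<longrightarrow> norm (x - z - s *\<^sub>R v) \<le> \<delta> v * s \<longrightarrow> stay G0 (n v) x \<le> ennreal (1 - p v))"
    by metis
  obtain D where D: "D \<subseteq> sphere 0 1" "finite D" "sphere 0 1 \<subseteq> (\<Union>v\<in>D. ball v (\<delta> v))"
  proof (rule compactE_image[of "sphere 0 (1::real)" "sphere 0 1" "\<lambda>v. ball v (\<delta> v)"])
    show "sphere 0 1 \<subseteq> (\<Union>v\<in>sphere 0 1. ball v (\<delta> v))" using * by force
  qed auto
  \<comment> \<open>The inserted elements make \<open>Max\<close> and \<open>Min\<close> meaningful
    without showing that \<open>D\<close> is nonempty.\<close>
  define N where "N = Max (insert 0 (n ` D))"
  define r where "r = Min (insert 1 (\<delta> ` D))"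
  define q where "q = Min (insert 1 (p ` D))"
  have N: "n v \<le> N" if "v \<in> D" for v using D(2) that by (simp add: N_def)
  have r: "r > 0" "\<And>v. v \<in> D \<Longrightarrow> r \<le> \<delta> v" using D(1,2) * by (auto simp: r_def subset_eq)
  have q: "q > 0" "\<And>v. v \<in> D \<Longrightarrow> q \<le> p v" using D(1,2) * by (auto simp: q_def subset_eq)
  have "stay G0 N x \<le> ennreal (1 - q)" if x: "x \<noteq> z" "norm (x - z) < r" for x
  proof -
    define s where "s = norm (x - z)"
    have s: "s > 0" "s < r" using x by (auto simp: s_def)
    define y where "y = (1 / s) *\<^sub>R (x - z)"
    have xy: "x - z = s *\<^sub>R y" using s by (simp add: y_def)
    have "y \<in> sphere 0 1" using s by (simp add: y_def s_def)
    then obtain v where v: "v \<in> D" "norm (y - v) < \<delta> v"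
      using D(3) by (auto simp: dist_norm norm_minus_commute)
    have "norm (x - z - s *\<^sub>R v) = s * norm (y - v)"
      using s by (simp add: xy scaleR_diff_right[symmetric])
    also have "\<dots> \<le> \<delta> v * s" using v s by simp
    finally have "stay G0 (n v) x \<le> ennreal (1 - p v)"
      using *[of v] v(1) D(1) s r(2)[OF v(1)] by (meson less_le_trans subsetD)
    moreover have "stay G0 N x \<le> stay G0 (n v) x" by (rule stay_antimono[OF N[OF v(1)]])
    moreover have "ennreal (1 - p v) \<le> ennreal (1 - q)" using q(2)[OF v(1)] by (intro ennreal_leI) simp
    ultimately show ?thesis by order
  qed
  moreover have "ennreal (1 - q) < 1" using q(1) by (simp add: ennreal_less_one_iff)
  ultimately show ?thesis using r(1) by blast
qed

text \<open>An orbit converging to \<open>z\<close> never equals \<open>z\<close>, satisfies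
  \<open>f \<ge> f z\<close> throughout because \<open>f\<close> decreases along it to
  \<open>f z\<close>, and is eventually near \<open>z\<close>. It would therefore remain in
  \<open>G\<close> from some time on, which has probability zero.\<close>

lemma AE_not_converges:
  assumes nondeg: "\<And>v. H *v v = 0 \<Longrightarrow> v = 0"
    and proj: "\<And>i. AE \<omega> in S. P_plus H \<omega> (axis i 1) \<noteq> 0"
    and x0: "x0 \<noteq> z"
  shows "AE \<omega> in S. \<not> orbit (grad f) x0 \<omega> \<longlonglongrightarrow> z"
proof -
  have b: "b > 0" using a_pos a_less_b by simp
  have diag: "b * \<bar>H $ i $ i\<bar> \<le> 1" for i
    using mult_left_mono[OF hessian_diag_le[of i], of b] b b_small by linarith
  have esc: "escapes v" if "v \<noteq> 0" for v
    by (rule qform_negative_reachable[OF hessian_symmetric a_pos diag nondeg proj that])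
       (assumption | erule (1) escapes_orbit)+
  have "\<exists>n r c. r > 0 \<and> c < 1 \<and> (\<forall>x. x \<noteq> z \<longrightarrow> norm (x - z) < r \<longrightarrow> stay G0 n x \<le> c)"
    by (rule uniform_escape) (rule esc)
  then obtain n r c where
    r: "r > 0" and c: "c < 1" and stay: "\<And>x. x \<noteq> z \<Longrightarrow> norm (x - z) < r \<Longrightarrow> stay G0 n x \<le> c"
    by blast
  define G where "G = {x. x \<noteq> z \<and> norm (x - z) < r \<and> f x \<ge> f z}"
  have [measurable]: "f \<in> borel_measurable borel" by (rule borel_measurable_continuous_onI[OF f_cont])
  have Gm: "G \<in> sets borel" unfolding G_def by measurable
  \<comment> \<open>The bound must hold for every \<open>x\<close>. With \<open>Suc n\<close> the
    starting point is certainly tested, so outside \<open>G\<close> the value is zero; inside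
    \<open>G\<close> the uniform escape bound applies.\<close>
  have "stay G (Suc n) x \<le> c" for x
  proof (cases "x \<in> G")
    case True
    have "stay G (Suc n) x \<le> stay G0 (Suc n) x" by (rule stay_mono_set) (auto simp: G_def)
    also have "\<dots> \<le> stay G0 n x" by (rule stay_Suc_le)
    also have "\<dots> \<le> c" using True by (intro stay) (auto simp: G_def)
    finally show ?thesis .
  qed simp
  from AE_eventually_leaves[OF Gm this c]
  have "AE \<omega> in S. \<forall>k. \<not> (\<forall>t\<ge>k. orbit (grad f) x0 \<omega> t \<in> G)"
    by (subst AE_all_countable) blast
  moreover have "AE \<omega> in S. \<omega> \<in> space S" by simp
  ultimately show ?thesis
  proof eventually_elim
    case (elim \<omega>)
    let ?x = "orbit (grad f) x0 \<omega>"
    have \<omega>: "\<omega> t \<in> space M" for t using elim(2) by (auto simp: space_PiM)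
    show ?case
    proof
      assume lim: "?x \<longlonglongrightarrow> z"
      have ne: "?x t \<noteq> z" for t
      proof (induction t)
        case (Suc t)
        obtain i \<alpha> where "\<omega> t = (i, \<alpha>)" "0 \<le> \<alpha>" "\<alpha> * L < 1" using step_size[OF \<omega>] by metis
        then show ?case using coord_step_neq_critical[OF critical _ _ Suc] by simp
      qed (use x0 in simp)
      have "decseq (\<lambda>t. f (?x t))"
      proof (rule decseq_SucI)
        fix t
        obtain i \<alpha> where "\<omega> t = (i, \<alpha>)" "0 \<le> \<alpha>" "\<alpha> * L < 1" using step_size[OF \<omega>] by metis
        then show "f (?x (Suc t)) \<le> f (?x t)" using coord_step_nonincreasing[of \<alpha> "?x t" i] by simp
      qed
      moreover have "(\<lambda>t. f (?x t)) \<longlonglongrightarrow> f z"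
        by (rule continuous_on_tendsto_compose[OF f_cont lim]) auto
      ultimately have "f z \<le> f (?x t)" for t by (rule decseq_ge)
      moreover obtain k where "\<forall>t\<ge>k. norm (?x t - z) < r" using LIMSEQ_D[OF lim r] by blast
      ultimately have "\<forall>t\<ge>k. ?x t \<in> G" using ne by (simp add: G_def)
      with elim(1) show False by blast
    qed
  qed
qed

end

section \<open>Countability of the strict saddle points and the conclusion\<close>

lemma countable_if_isolated:
  fixes X :: "'a::{metric_space, second_countable_topology} set"
  assumes "\<And>x. x \<in> X \<Longrightarrow> \<exists>\<delta>>0. \<forall>y\<in>X. dist y x < \<delta> \<longrightarrow> y = x"
  shows "countable X"
proof -
  obtain \<delta> where \<delta>: "\<And>x. x \<in> X \<Longrightarrow> \<delta> x > 0" "\<And>x y. x \<in> X \<Longrightarrow> y \<in> X \<Longrightarrow> dist y x < \<delta> x \<Longrightarrow> y = x"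
    using assms by metis
  let ?b = "\<lambda>x. ball x (\<delta> x / 2)"
  \<comment> \<open>Radii are halved so that a common point of two balls puts the centres closer
    than the larger of the two full radii.\<close>
  have disj: "x = y" if x: "x \<in> X" and y: "y \<in> X" and p: "p \<in> ?b x" "p \<in> ?b y" for x y p
  proof -
    have "dist x y < \<delta> x / 2 + \<delta> y / 2" using p dist_triangle2[of x y p] by (simp add: dist_commute)
    then have "dist y x < \<delta> x \<or> dist x y < \<delta> y" by (auto simp: dist_commute)
    then show ?thesis using \<delta>(2) x y by blast
  qed
  have centre: "x \<in> ?b x" if "x \<in> X" for x using \<delta>(1)[OF that] by simp
  have "countable (?b ` X)"
  proof (rule countable_disjoint_open_subsets)
    show "pairwise disjnt (?b ` X)" unfolding pairwise_def disjnt_def using disj by blast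
  qed auto
  moreover have "inj_on ?b X"
    by (rule inj_onI) (metis centre disj)
  ultimately show ?thesis by (rule countable_image_inj_on)
qed

text \<open>Writes convergence with countable quantifiers only, so that the set of convergent paths
  is seen to be measurable.\<close>

lemma LIMSEQ_iff_inverse_Suc:
  "X \<longlonglongrightarrow> x \<longleftrightarrow> (\<forall>j. \<exists>k. \<forall>t\<ge>k. dist (X t) x < inverse (real (Suc j)))"
proof
  assume "X \<longlonglongrightarrow> x"
  then show "\<forall>j. \<exists>k. \<forall>t\<ge>k. dist (X t) x < inverse (real (Suc j))"
    unfolding lim_sequentially by simp
next
  assume *: "\<forall>j. \<exists>k. \<forall>t\<ge>k. dist (X t) x < inverse (real (Suc j))"
  show "X \<longlonglongrightarrow> x"
    unfolding lim_sequentially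
  proof (intro allI impI)
    fix e :: real assume "e > 0"
    then obtain j where "inverse (real (Suc j)) < e" using reals_Archimedean by blast
    with * show "\<exists>k. \<forall>t\<ge>k. dist (X t) x < e" by (meson less_trans)
  qed
qed

theorem theorem1:
  fixes f :: "real^'n \<Rightarrow> real" and M \<alpha>_min \<alpha>_max :: real and x0 :: "real^'n"
  assumes f_C2: "C2 f"
    and M_pos: "M > 0"
    and hessian_bound: "\<And>x. onorm (\<lambda>v. hessian f x *v v) \<le> M"
    and nondegenerate: "\<And>xs l. xs \<in> crit_s f \<Longrightarrow> l \<in> eigenvalues (hessian f xs) \<Longrightarrow> l \<noteq> 0"
    and projection: "\<And>xs i. xs \<in> crit_s f \<Longrightarrow>
      AE \<omega> in path_space \<alpha>_min \<alpha>_max. P_plus (hessian f xs) \<omega> (axis i 1) \<noteq> 0"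
    and step_sizes: "0 < \<alpha>_min" "\<alpha>_min < \<alpha>_max" "\<alpha>_max < 1 / M"
    and x0: "x0 \<notin> crit_s f"
  shows "Omega_s_crit f \<alpha>_min \<alpha>_max x0 \<in> null_sets (path_space \<alpha>_min \<alpha>_max)"
proof -
  let ?S = "path_space \<alpha>_min \<alpha>_max :: (nat \<Rightarrow> 'n \<times> real) measure"
  have nondeg: "v = 0" if "xs \<in> crit_s f" "hessian f xs *v v = 0" for xs v
  proof (rule ccontr)
    assume "v \<noteq> 0"
    then have "0 \<in> eigenvalues (hessian f xs)"
      using that(2) by (auto simp: eigenvalues_def eigenspace_def)
    then show False using nondegenerate[OF that(1)] by blast
  qed
  have loc: "rcgd_critical f M xs \<alpha>_min \<alpha>_max (step_space \<alpha>_min \<alpha>_max)" if "xs \<in> crit_s f" for xs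
  proof
    show "grad f xs = 0" using that by (simp add: crit_s_def)
    show "\<alpha>_max * M < 1" using step_sizes(3) M_pos by (simp add: field_simps)
  qed (use f_C2 M_pos hessian_bound step_sizes in auto)
  have null: "Omega_s f \<alpha>_min \<alpha>_max xs x0 \<in> null_sets ?S" if xs: "xs \<in> crit_s f" for xs
  proof -
    interpret rcgd_critical f M xs \<alpha>_min \<alpha>_max "step_space \<alpha>_min \<alpha>_max" by (rule loc[OF xs])
    have "AE \<omega> in S. \<not> orbit (grad f) x0 \<omega> \<longlonglongrightarrow> xs"
    proof (rule AE_not_converges)
      show "v = 0" if "hessian f xs *v v = 0" for v using nondeg[OF xs that] .
      show "AE \<omega> in S. P_plus (hessian f xs) \<omega> (axis i 1) \<noteq> 0" for i
        using projection[OF xs, of i] unfolding path_space_def .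
      show "x0 \<noteq> xs" using xs x0 by blast
    qed
    moreover have "Omega_s f \<alpha>_min \<alpha>_max xs x0 = {\<omega> \<in> space S. orbit (grad f) x0 \<omega> \<longlonglongrightarrow> xs}"
      by (simp add: Omega_s_def rcgd_eq_orbit path_space_def)
    moreover have "{\<omega> \<in> space S. orbit (grad f) x0 \<omega> \<longlonglongrightarrow> xs} \<in> sets S"
      unfolding LIMSEQ_iff_inverse_Suc by measurable
    ultimately show ?thesis by (simp add: path_space_def AE_iff_null)
  qed
  have "countable (crit_s f)"
  proof (rule countable_if_isolated)
    fix xs assume xs: "xs \<in> crit_s f"
    interpret rcgd_critical f M xs \<alpha>_min \<alpha>_max "step_space \<alpha>_min \<alpha>_max" by (rule loc[OF xs])
    \<comment> \<open>Every strict saddle point has zero gradient, so isolation among the critical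
      points gives isolation within \<open>crit_s f\<close>.\<close>
    have "\<exists>\<delta>>0. \<forall>y. y \<noteq> xs \<longrightarrow> dist y xs < \<delta> \<longrightarrow> grad f y \<noteq> 0"
      by (rule critical_isolated) (rule nondeg[OF xs])
    then show "\<exists>\<delta>>0. \<forall>y\<in>crit_s f. dist y xs < \<delta> \<longrightarrow> y = xs"
      unfolding crit_s_def by blast
  qed
  with null show ?thesis unfolding Omega_s_crit_def by (intro null_sets_UN') auto
qed

end
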